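(* Let $L_0$ be an ortholattice and let $f:L_0\to L_0$ be any function. Then there is an ortholattice $L^*$ extending $L_0$ (i.e. containing $L_0$ as a subortholattice) such that $f$ is the restriction to $L_0$ of a polynomial function over $L^*$; that is, there is a unary ortholattice polynomial $p(\mathtt{x})$ with coefficients in $L^*$ such that $p(a)=f(a)$ for all $a\in L_0$. Moreover, if $L_0$ is complete, then $L^*$ can be chosen of the form $L^*=\mathrm{ortho}(L_1,L_0)$ for some complete lattice $L_1$ with $L_0\trianglelefteq L_1$.
   Context: An ortholattice is a bounded lattice $(L,\vee,\wedge,0,1)$ with a unary operation $x\mapsto x^{\perp}$ satisfying, for all $x,y$: $x\le y\Rightarrow x^\perp\ge y^\perp$, $(x^\perp)^\perp=x$, $x\vee x^\perp=1$, $x\wedge x^\perp=0$. A subortholattice is a subset closed under $\vee,\wedge,{}^\perp$ and containing $0,1$. An ortholattice is complete if it is complete as a partial order. An ortholattice polynomial (orthopolynomial) with coefficients in $L^*$ is a term built from variables and elements of $L^*$ using $\vee,\wedge,{}^\perp$. For bounded lattices, $L_0\le L_1$ means that $L_0$ is a $\{0,1\}$-sublattice of $L_1$ (a sublattice with the same least and greatest elements). $L_0\trianglelefteq L_1$ means: (a) $L_0\le L_1$; (b) for every $x\in L_1$ the set $\{z\in L_0: z\le_{L_1}x\}$ has a greatest element; (c) $L_0$ is downward closed in $L_1$ in the following sense: for all $z\in L_0\setminus\{1\}$ and all $x\in L_1$, if $x\le z$ then $x\in L_0$. Construction of $\mathrm{ortho}(L_1,L_0)$: let $L_0$ be an ortholattice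 with orthocomplement ${}^{\perp_0}$ and $L_1$ a bounded lattice with $L_0\trianglelefteq L_1$. Choose a set $L_2$ and a bijection $\iota:L_1\to L_2$ with $L_1\cap L_2=L_0$ and $\iota(z)=z^{\perp_0}$ for all $z\in L_0$. Order $L_2$ by $\iota(x)\le_2\iota(y)$ iff $y\le_1 x$. Then $\mathrm{ortho}(L_1,L_0)$ is the set $L_1\cup L_2$ ordered by the transitive closure of $(\le_1)\cup(\le_2)$ (this is a lattice), with orthocomplement $x^\perp=\iota(x)$ for $x\in L_1$ and $x^\perp=\iota^{-1}(x)$ for $x\in L_2$. *)

theory Defs
  imports "HOL-Algebra.Complete_Lattice"
begin

record 'a ortho_struct = "'a gorder" +
  ocompl :: "'a \<Rightarrow> 'a"  (\<open>(_\<^sup>\<bottom>\<index>)\<close> [1000] 999)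

locale ortholattice = bounded_lattice L for L :: "('a, 'm) ortho_struct_scheme" (structure) +
  assumes ocompl_closed: "x \<in> carrier L \<Longrightarrow> x\<^sup>\<bottom> \<in> carrier L"
    and ocompl_antitone:
      "\<lbrakk>x \<in> carrier L; y \<in> carrier L; x \<sqsubseteq> y\<rbrakk> \<Longrightarrow> y\<^sup>\<bottom> \<sqsubseteq> x\<^sup>\<bottom>"
    and ocompl_involutive: "x \<in> carrier L \<Longrightarrow> (x\<^sup>\<bottom>)\<^sup>\<bottom> = x"
    and join_ocompl: "x \<in> carrier L \<Longrightarrow> x \<squnion> x\<^sup>\<bottom> = \<top>"
    and meet_ocompl: "x \<in> carrier L \<Longrightarrow> x \<sqinter> x\<^sup>\<bottom> = \<bottom>"

text \<open>The substructure is given as a record of its own, whose order and operations must agree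
  with those of the larger structure; closure under the operations is then contained in
  the requirement that the smaller record is itself a bounded lattice (ortholattice).\<close>

definition bounded_sublattice ::
    "('a, 'm) gorder_scheme \<Rightarrow> ('a, 'n) gorder_scheme \<Rightarrow> bool" where
  "bounded_sublattice L0 L1 \<longleftrightarrow>
     bounded_lattice L0 \<and> bounded_lattice L1 \<and> carrier L0 \<subseteq> carrier L1 \<and>
     (\<forall>x\<in>carrier L0. \<forall>y\<in>carrier L0.
        (x \<sqsubseteq>\<^bsub>L0\<^esub> y \<longleftrightarrow> x \<sqsubseteq>\<^bsub>L1\<^esub> y) \<and>
        x \<squnion>\<^bsub>L0\<^esub> y = x \<squnion>\<^bsub>L1\<^esub> y \<and> x \<sqinter>\<^bsub>L0\<^esub> y = x \<sqinter>\<^bsub>L1\<^esub> y) \<and>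
     \<bottom>\<^bsub>L0\<^esub> = \<bottom>\<^bsub>L1\<^esub> \<and> \<top>\<^bsub>L0\<^esub> = \<top>\<^bsub>L1\<^esub>"

definition subortholattice ::
    "('a, 'm) ortho_struct_scheme \<Rightarrow> ('a, 'n) ortho_struct_scheme \<Rightarrow> bool" where
  "subortholattice L0 L \<longleftrightarrow>
     ortholattice L0 \<and> ortholattice L \<and> bounded_sublattice L0 L \<and>
     (\<forall>x\<in>carrier L0. x\<^sup>\<bottom>\<^bsub>L0\<^esub> = x\<^sup>\<bottom>\<^bsub>L\<^esub>)"

definition normal_sublattice ::
    "('a, 'm) gorder_scheme \<Rightarrow> ('a, 'n) gorder_scheme \<Rightarrow> bool"  (infix \<open>\<unlhd>\<close> 50) where
  "L0 \<unlhd> L1 \<longleftrightarrow>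
     bounded_sublattice L0 L1 \<and>
     (\<forall>x\<in>carrier L1. \<exists>g. greatest L1 g {z \<in> carrier L0. z \<sqsubseteq>\<^bsub>L1\<^esub> x}) \<and>
     (\<forall>z\<in>carrier L0 - {\<top>\<^bsub>L1\<^esub>}. \<forall>x\<in>carrier L1. x \<sqsubseteq>\<^bsub>L1\<^esub> z \<longrightarrow> x \<in> carrier L0)"

text \<open>The map \<open>\<iota>\<close> is the chosen bijection from \<open>carrier L1\<close> onto the set \<open>\<iota> ` carrier L1\<close>, which
  plays the role of the second (order-reversed) copy of \<open>L1\<close>.\<close>

definition dual_copy_map ::
    "('a, 'm) ortho_struct_scheme \<Rightarrow> ('a, 'n) gorder_scheme \<Rightarrow> ('a \<Rightarrow> 'a) \<Rightarrow> bool" where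
  "dual_copy_map L0 L1 \<iota> \<longleftrightarrow>
     inj_on \<iota> (carrier L1) \<and>
     carrier L1 \<inter> \<iota> ` carrier L1 = carrier L0 \<and>
     (\<forall>z\<in>carrier L0. \<iota> z = z\<^sup>\<bottom>\<^bsub>L0\<^esub>)"

definition ortho_glue :: "('a, 'n) gorder_scheme \<Rightarrow> ('a \<Rightarrow> 'a) \<Rightarrow> 'a ortho_struct" where
  "ortho_glue L1 \<iota> =
     \<lparr> carrier = carrier L1 \<union> \<iota> ` carrier L1,
       eq = (=),
       le = (\<lambda>u v. (u, v) \<in>
              ({(x, y). x \<in> carrier L1 \<and> y \<in> carrier L1 \<and> x \<sqsubseteq>\<^bsub>L1\<^esub> y} \<union>
               {(\<iota> x, \<iota> y) | x y. x \<in> carrier L1 \<and> y \<in> carrier L1 \<and> y \<sqsubseteq>\<^bsub>L1\<^esub> x})\<^sup>+),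
       ocompl = (\<lambda>u. if u \<in> carrier L1 then \<iota> u else inv_into (carrier L1) \<iota> u) \<rparr>"

text \<open>\<open>L\<close> is one of the (mutually isomorphic) realisations of \<open>ortho(L1, L0)\<close>.\<close>

definition is_ortho ::
    "'a ortho_struct \<Rightarrow> ('a, 'n) gorder_scheme \<Rightarrow> ('a, 'm) ortho_struct_scheme \<Rightarrow> bool" where
  "is_ortho L L1 L0 \<longleftrightarrow>
     ortholattice L0 \<and> L0 \<unlhd> L1 \<and> (\<exists>\<iota>. dual_copy_map L0 L1 \<iota> \<and> L = ortho_glue L1 \<iota>)"

text \<open>Transport of structure along a map \<open>h\<close> that is injective on the carrier. It is used to place
  an ortholattice inside a larger type, where it can be literally contained in others.\<close>

definition ortho_copy :: "('a \<Rightarrow> 'b) \<Rightarrow> ('a, 'm) ortho_struct_scheme \<Rightarrow> 'b ortho_struct" where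
  "ortho_copy h L =
     \<lparr> carrier = h ` carrier L,
       eq = (=),
       le = (\<lambda>u v. inv_into (carrier L) h u \<sqsubseteq>\<^bsub>L\<^esub> inv_into (carrier L) h v),
       ocompl = (\<lambda>u. h ((inv_into (carrier L) h u)\<^sup>\<bottom>\<^bsub>L\<^esub>)) \<rparr>"

datatype (poly_vars: 'v, coefficients: 'a) orthopoly =
    Var 'v
  | Coeff 'a
  | Join "('v, 'a) orthopoly" "('v, 'a) orthopoly"
  | Meet "('v, 'a) orthopoly" "('v, 'a) orthopoly"
  | Compl "('v, 'a) orthopoly"

primrec orthopoly_eval ::
    "('a, 'm) ortho_struct_scheme \<Rightarrow> ('v \<Rightarrow> 'a) \<Rightarrow> ('v, 'a) orthopoly \<Rightarrow> 'a" where
  "orthopoly_eval L s (Var v) = s v"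
| "orthopoly_eval L s (Coeff c) = c"
| "orthopoly_eval L s (Join p q) = orthopoly_eval L s p \<squnion>\<^bsub>L\<^esub> orthopoly_eval L s q"
| "orthopoly_eval L s (Meet p q) = orthopoly_eval L s p \<sqinter>\<^bsub>L\<^esub> orthopoly_eval L s q"
| "orthopoly_eval L s (Compl p) = (orthopoly_eval L s p)\<^sup>\<bottom>\<^bsub>L\<^esub>"

text \<open>Up to the identification of \<open>L0\<close> with its copy under \<open>h\<close>: the ortholattice \<open>L\<close> extends \<open>L0\<close>,
  and \<open>f\<close> is the restriction to \<open>L0\<close> of a unary polynomial function with coefficients in \<open>L\<close>.\<close>

definition polynomial_extension ::
    "('a \<Rightarrow> 'b) \<Rightarrow> ('a, 'm) ortho_struct_scheme \<Rightarrow> ('a \<Rightarrow> 'a) \<Rightarrow> ('b, 'n) ortho_struct_scheme \<Rightarrow> bool"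
  where
  "polynomial_extension h L0 f L \<longleftrightarrow>
     ortholattice L \<and> subortholattice (ortho_copy h L0) L \<and>
     (\<exists>p :: (unit, 'b) orthopoly. coefficients p \<subseteq> carrier L \<and>
        (\<forall>a\<in>carrier L0. orthopoly_eval L (\<lambda>_. h a) p = h (f a)))"

text \<open>Since types cannot be quantified existentially, extensions of an ortholattice over \<open>'a\<close> are
  sought in a fixed type: the summand \<open>Inl\<close> holds \<open>L0\<close>, the other one provides
  \<open>max (card 'a) aleph_0\<close> new elements.\<close>

type_synonym 'a ext = "'a + nat \<times> 'a list"

end

theory Submission
  imports Defs
begin

text \<open>
  Every orthopolynomial in \<open>x\<close> is a monotone lattice polynomial in the pair \<open>(x, x\<^sup>\<bottom>)\<close>, and the
  pairs \<open>(a, a\<^sup>\<bottom>)\<close> with \<open>a \<in> L0\<close> form an antichain. So monotonicity puts no constraint on the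
  values at these pairs, provided that \<open>L0\<close> is extended by new elements that tell the pairs apart.
  The extension is \<open>ortho(L1, L0)\<close> for a lattice \<open>L1\<close> designed around two observations.

  \<^bold>\<open>Values may be encoded as cores.\<close> For \<open>w \<in> L1\<close> write \<open>core w\<close> for the greatest element of \<open>L0\<close>
  below \<open>w\<close>. In \<open>ortho(L1, L0)\<close> an element \<open>u\<close> of \<open>L1\<close> that is not in \<open>L0 - {1}\<close> has no upper
  bounds in the dual copy except \<open>1\<close>, hence \<open>u \<squnion> \<iota> y = u \<squnion> (core y)\<^sup>\<bottom>\<close> (lemma \<open>join_G12\<close>).
  Applied twice, once in dual form, this gives \<open>(w \<sqinter> \<iota> e) \<squnion> e' = core w \<squnion> e'\<close> for suitable new
  elements \<open>e\<close> and \<open>e'\<close> (lemma \<open>join_meet_recovers_core\<close>). If \<open>L1\<close> contains two new elements \<open>h\<close>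
  and \<open>c\<close> with \<open>(x \<squnion> h) \<sqinter> (x \<squnion> c) = x\<close> for all \<open>x \<in> L0\<close>, then \<open>core w\<close> is a polynomial in \<open>w\<close>.
  It therefore suffices to find a polynomial whose value at \<open>a\<close> is an element of \<open>L1\<close> with
  core \<open>f a\<close>; that element is allowed to lie outside \<open>L0\<close>.

  \<^bold>\<open>Marks.\<close> Each element \<open>u\<close> of \<open>L1\<close>, called a cell, has a core \<open>proj u \<in> L0\<close> and a set \<open>marks u\<close>
  of formal marks: one point for every element of \<open>L0\<close> and three flags \<open>Star\<close>, \<open>Lo\<close>, \<open>Hi\<close>. Cells are
  ordered componentwise. Elements \<open>x \<noteq> 1\<close> of \<open>L0\<close> carry no mark, and the other cells below \<open>1\<close> are
    \<^item> \<open>lo a\<close>, core \<open>a\<close>, marked by \<open>Lo\<close> and the points in \<open>[0, a]\<close>;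
    \<^item> \<open>hi b\<close>, core \<open>b\<close>, marked by \<open>Hi\<close> and the points in \<open>[b\<^sup>\<bottom>, 1]\<close>;
    \<^item> \<open>interval x b a\<close>, core \<open>x\<close>, marked by the points in \<open>[b, a]\<close>;
    \<^item> \<open>star x\<close>, core \<open>x\<close>, marked by \<open>Star\<close>;
    \<^item> \<open>hit a\<close>, core \<open>f a\<close>, marked by \<open>Star\<close> and the point \<open>a\<close>.

  With \<open>c = lo 0\<close>, \<open>d = hi 0\<close> and \<open>q = interval 0 0 1\<close> the flags force \<open>a \<squnion> c = lo a\<close> and
  \<open>a\<^sup>\<bottom> \<squnion> d = hi (a\<^sup>\<bottom>)\<close>, so that \<open>q \<sqinter> (a \<squnion> c) \<sqinter> (a\<^sup>\<bottom> \<squnion> d)\<close> has core \<open>0\<close> and the single point \<open>a\<close> as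
  its mark (lemma \<open>address_polynomial\<close>). These cells are pairwise incomparable, and since no cell
  below \<open>1\<close> other than \<open>hit a\<close> has both \<open>Star\<close> and the point \<open>a\<close> among its marks, joining with
  \<open>h = star 0\<close> yields \<open>hit a\<close>, with the prescribed core \<open>f a\<close>. (The cells with core \<open>1\<close> are all
  identified with \<open>1\<close>.)

  The intervals make the family of mark sets closed under intersection, and among the cells above
  two given ones there is always a least one; so \<open>L1\<close> is a lattice, and by the same argument a
  complete one if \<open>L0\<close> is complete. The same \<open>L1\<close> therefore serves both parts of the theorem.
\<close>

section \<open>Joins, meets and bounds from elementwise conditions\<close>

lemma (in partial_order) join_eqI:
  assumes "x \<in> carrier L" "y \<in> carrier L" "s \<in> carrier L" "x \<sqsubseteq> s" "y \<sqsubseteq> s"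
    and "\<And>t. \<lbrakk>t \<in> carrier L; x \<sqsubseteq> t; y \<sqsubseteq> t\<rbrakk> \<Longrightarrow> s \<sqsubseteq> t"
  shows "x \<squnion> y = s"
proof -
  have "is_lub L s {x, y}"
    using assms by (simp add: least_def Upper_def)
  then show ?thesis
    unfolding join_def Lattice.sup_def by (metis (mono_tags) some_equality least_unique)
qed

lemma (in partial_order) meet_eqI:
  assumes "x \<in> carrier L" "y \<in> carrier L" "i \<in> carrier L" "i \<sqsubseteq> x" "i \<sqsubseteq> y"
    and "\<And>t. \<lbrakk>t \<in> carrier L; t \<sqsubseteq> x; t \<sqsubseteq> y\<rbrakk> \<Longrightarrow> t \<sqsubseteq> i"
  shows "x \<sqinter> y = i"
proof -
  have "is_glb L i {x, y}"
    using assms by (simp add: greatest_def Lower_def)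
  then show ?thesis
    unfolding meet_def Lattice.inf_def by (metis (mono_tags) some_equality greatest_unique)
qed

lemma (in partial_order) top_eqI:
  assumes "t \<in> carrier L" "\<And>x. x \<in> carrier L \<Longrightarrow> x \<sqsubseteq> t"
  shows "\<top> = t"
proof -
  have "greatest L t (carrier L)"
    using assms by (simp add: greatest_def)
  then show ?thesis
    unfolding top_def by (metis (mono_tags) some_equality greatest_unique)
qed

lemma (in partial_order) bottom_eqI:
  assumes "b \<in> carrier L" "\<And>x. x \<in> carrier L \<Longrightarrow> b \<sqsubseteq> x"
  shows "\<bottom> = b"
proof -
  have "least L b (carrier L)"
    using assms by (simp add: least_def)
  then show ?thesis
    unfolding bottom_def by (metis (mono_tags) some_equality least_unique)
qed

lemma partial_orderI:
  assumes "eq L = (=)"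
    and "\<And>x. x \<in> carrier L \<Longrightarrow> x \<sqsubseteq>\<^bsub>L\<^esub> x"
    and "\<And>x y. \<lbrakk>x \<in> carrier L; y \<in> carrier L; x \<sqsubseteq>\<^bsub>L\<^esub> y; y \<sqsubseteq>\<^bsub>L\<^esub> x\<rbrakk> \<Longrightarrow> x = y"
    and "\<And>x y z. \<lbrakk>x \<in> carrier L; y \<in> carrier L; z \<in> carrier L; x \<sqsubseteq>\<^bsub>L\<^esub> y; y \<sqsubseteq>\<^bsub>L\<^esub> z\<rbrakk> \<Longrightarrow> x \<sqsubseteq>\<^bsub>L\<^esub> z"
  shows "partial_order L"
  unfolding partial_order_def partial_order_axioms_def weak_partial_order_def
    weak_partial_order_axioms_def equivalence_def
  unfolding assms(1) using assms(2-) by blast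

lemma (in partial_order) bounded_latticeI:
  assumes "\<And>x y. \<lbrakk>x \<in> carrier L; y \<in> carrier L\<rbrakk> \<Longrightarrow>
      \<exists>s\<in>carrier L. x \<sqsubseteq> s \<and> y \<sqsubseteq> s \<and> (\<forall>t\<in>carrier L. x \<sqsubseteq> t \<and> y \<sqsubseteq> t \<longrightarrow> s \<sqsubseteq> t)"
    and "\<And>x y. \<lbrakk>x \<in> carrier L; y \<in> carrier L\<rbrakk> \<Longrightarrow>
      \<exists>i\<in>carrier L. i \<sqsubseteq> x \<and> i \<sqsubseteq> y \<and> (\<forall>t\<in>carrier L. t \<sqsubseteq> x \<and> t \<sqsubseteq> y \<longrightarrow> t \<sqsubseteq> i)"
    and "b \<in> carrier L" "\<And>x. x \<in> carrier L \<Longrightarrow> b \<sqsubseteq> x"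
    and "t \<in> carrier L" "\<And>x. x \<in> carrier L \<Longrightarrow> x \<sqsubseteq> t"
  shows "bounded_lattice L"
proof unfold_locales
  fix x y assume xy: "x \<in> carrier L" "y \<in> carrier L"
  from assms(1)[OF xy] obtain s where
    "s\<in>carrier L" "x \<sqsubseteq> s" "y \<sqsubseteq> s" "\<forall>t\<in>carrier L. x \<sqsubseteq> t \<and> y \<sqsubseteq> t \<longrightarrow> s \<sqsubseteq> t" by blast
  with xy have "is_lub L s {x, y}"
    by (simp add: least_def Upper_def)
  then show "\<exists>s. is_lub L s {x, y}" ..
  from assms(2)[OF xy] obtain i where
    "i\<in>carrier L" "i \<sqsubseteq> x" "i \<sqsubseteq> y" "\<forall>t\<in>carrier L. t \<sqsubseteq> x \<and> t \<sqsubseteq> y \<longrightarrow> t \<sqsubseteq> i" by blast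
  with xy have "is_glb L i {x, y}"
    by (simp add: greatest_def Lower_def)
  then show "\<exists>i. is_glb L i {x, y}" ..
next
  show "\<exists>b. least L b (carrier L)"
    using assms(3,4) by (auto simp: least_def)
  show "\<exists>t. greatest L t (carrier L)"
    using assms(5,6) by (auto simp: greatest_def)
qed

text \<open>The infimum of a set is the supremum of its lower bounds.\<close>

lemma (in partial_order) complete_lattice_from_sups:
  assumes sups: "\<And>A. A \<subseteq> carrier L \<Longrightarrow> \<exists>s. is_lub L s A"
  shows "complete_lattice L"
proof (rule complete_latticeI[OF sups])
  fix A assume A: "A \<subseteq> carrier L"
  obtain s where s: "is_lub L s (Lower L A)"
    using sups[of "Lower L A"] by auto
  have "greatest L s (Lower L A)"
  proof (rule greatest_LowerI)
    fix x assume "x \<in> A"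
    then have "x \<in> Upper L (Lower L A)"
      using A by (intro Upper_memI) blast+
    then show "s \<sqsubseteq> x" using s by (rule least_le[rotated])
  next
    fix y assume "y \<in> Lower L A"
    then show "y \<sqsubseteq> s" using least_Upper_above[OF s] by simp
  qed (use A s in \<open>simp_all add: least_closed[OF s]\<close>)
  then show "\<exists>i. is_glb L i A" ..
qed

section \<open>Transport of an ortholattice along an injection\<close>

context
  fixes L :: "('a, 'm) ortho_struct_scheme" and h :: "'a \<Rightarrow> 'b"
  assumes ol: "ortholattice L" and inj: "inj_on h (carrier L)"
begin

interpretation L: ortholattice L by (rule ol)

lemma ortho_copy_carrier: "carrier (ortho_copy h L) = h ` carrier L"
  by (simp add: ortho_copy_def)

lemma ortho_copy_le:
  "\<lbrakk>x \<in> carrier L; y \<in> carrier L\<rbrakk> \<Longrightarrow> h x \<sqsubseteq>\<^bsub>ortho_copy h L\<^esub> h y \<longleftrightarrow> x \<sqsubseteq>\<^bsub>L\<^esub> y"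
  by (simp add: ortho_copy_def inj)

lemma ortho_copy_ocompl:
  "x \<in> carrier L \<Longrightarrow> (h x)\<^sup>\<bottom>\<^bsub>ortho_copy h L\<^esub> = h (x\<^sup>\<bottom>\<^bsub>L\<^esub>)"
  by (simp add: ortho_copy_def inj)

lemma partial_order_ortho_copy: "partial_order (ortho_copy h L)"
proof (rule partial_orderI)
  show "eq (ortho_copy h L) = (=)" by (simp add: ortho_copy_def)
next
  fix u v w
  assume "u \<in> carrier (ortho_copy h L)" "v \<in> carrier (ortho_copy h L)" "w \<in> carrier (ortho_copy h L)"
    and "u \<sqsubseteq>\<^bsub>ortho_copy h L\<^esub> v" "v \<sqsubseteq>\<^bsub>ortho_copy h L\<^esub> w"
  then show "u \<sqsubseteq>\<^bsub>ortho_copy h L\<^esub> w"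
    by (clarsimp simp: ortho_copy_carrier ortho_copy_le) (meson L.le_trans)
next
  fix u v
  assume "u \<in> carrier (ortho_copy h L)" "v \<in> carrier (ortho_copy h L)"
    and "u \<sqsubseteq>\<^bsub>ortho_copy h L\<^esub> v" "v \<sqsubseteq>\<^bsub>ortho_copy h L\<^esub> u"
  then show "u = v"
    by (clarsimp simp: ortho_copy_carrier ortho_copy_le) (metis L.le_antisym)
qed (clarsimp simp: ortho_copy_carrier ortho_copy_le)

interpretation C: partial_order "ortho_copy h L" by (rule partial_order_ortho_copy)

lemma ortho_copy_join:
  "\<lbrakk>x \<in> carrier L; y \<in> carrier L\<rbrakk> \<Longrightarrow> h x \<squnion>\<^bsub>ortho_copy h L\<^esub> h y = h (x \<squnion>\<^bsub>L\<^esub> y)"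
  by (rule C.join_eqI; clarsimp simp: ortho_copy_carrier ortho_copy_le L.join_left L.join_right L.join_le)+

lemma ortho_copy_meet:
  "\<lbrakk>x \<in> carrier L; y \<in> carrier L\<rbrakk> \<Longrightarrow> h x \<sqinter>\<^bsub>ortho_copy h L\<^esub> h y = h (x \<sqinter>\<^bsub>L\<^esub> y)"
  by (rule C.meet_eqI; clarsimp simp: ortho_copy_carrier ortho_copy_le L.meet_left L.meet_right L.meet_le)+

lemma ortho_copy_top: "\<top>\<^bsub>ortho_copy h L\<^esub> = h \<top>\<^bsub>L\<^esub>"
  by (rule C.top_eqI) (clarsimp simp: ortho_copy_carrier ortho_copy_le)+

lemma ortho_copy_bottom: "\<bottom>\<^bsub>ortho_copy h L\<^esub> = h \<bottom>\<^bsub>L\<^esub>"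
  by (rule C.bottom_eqI) (clarsimp simp: ortho_copy_carrier ortho_copy_le)+

lemma ortholattice_ortho_copy: "ortholattice (ortho_copy h L)"
proof (rule ortholattice.intro)
  show "bounded_lattice (ortho_copy h L)"
  proof (rule C.bounded_latticeI)
    fix u v assume "u \<in> carrier (ortho_copy h L)" "v \<in> carrier (ortho_copy h L)"
    then obtain x y where xy: "x \<in> carrier L" "y \<in> carrier L" "u = h x" "v = h y"
      by (auto simp: ortho_copy_carrier)
    show "\<exists>s\<in>carrier (ortho_copy h L). u \<sqsubseteq>\<^bsub>ortho_copy h L\<^esub> s \<and> v \<sqsubseteq>\<^bsub>ortho_copy h L\<^esub> s \<and>
       (\<forall>t\<in>carrier (ortho_copy h L). u \<sqsubseteq>\<^bsub>ortho_copy h L\<^esub> t \<and> v \<sqsubseteq>\<^bsub>ortho_copy h L\<^esub> t \<longrightarrow> s \<sqsubseteq>\<^bsub>ortho_copy h L\<^esub> t)"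
      using xy by (intro bexI[of _ "h (x \<squnion>\<^bsub>L\<^esub> y)"])
        (clarsimp simp: ortho_copy_carrier ortho_copy_le L.join_left L.join_right L.join_le)+
    show "\<exists>s\<in>carrier (ortho_copy h L). s \<sqsubseteq>\<^bsub>ortho_copy h L\<^esub> u \<and> s \<sqsubseteq>\<^bsub>ortho_copy h L\<^esub> v \<and>
       (\<forall>t\<in>carrier (ortho_copy h L). t \<sqsubseteq>\<^bsub>ortho_copy h L\<^esub> u \<and> t \<sqsubseteq>\<^bsub>ortho_copy h L\<^esub> v \<longrightarrow> t \<sqsubseteq>\<^bsub>ortho_copy h L\<^esub> s)"
      using xy by (intro bexI[of _ "h (x \<sqinter>\<^bsub>L\<^esub> y)"])
        (clarsimp simp: ortho_copy_carrier ortho_copy_le L.meet_left L.meet_right L.meet_le)+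
    next
    show "h \<bottom>\<^bsub>L\<^esub> \<in> carrier (ortho_copy h L)" "h \<top>\<^bsub>L\<^esub> \<in> carrier (ortho_copy h L)"
      by (simp_all add: ortho_copy_carrier)
  qed (clarsimp simp: ortho_copy_carrier ortho_copy_le)+
qed (unfold_locales, (clarsimp simp: ortho_copy_carrier ortho_copy_le ortho_copy_ocompl
      ortho_copy_join ortho_copy_meet ortho_copy_top ortho_copy_bottom
      L.ocompl_closed L.ocompl_antitone L.ocompl_involutive L.join_ocompl L.meet_ocompl)+)

end

section \<open>The ortholattice \<open>ortho(L1, L0)\<close>\<close>

text \<open>In the names of the facts about the glued order, the digits 1 and 2 tell for each argument whether
it is given as an element \<open>u\<close> of \<open>L1\<close> or as an element \<open>\<iota> x\<close> of the dual copy; an element of \<open>L0\<close>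
may be presented in either way. The restriction of \<open>\<iota>\<close> to \<open>L0\<close> being the orthocomplement makes
the two presentations compatible.\<close>

locale ortho_gluing =
  fixes L0 :: "('a, 'm) ortho_struct_scheme" and L1 :: "('a, 'n) gorder_scheme"
    and \<iota> :: "'a \<Rightarrow> 'a"
  assumes ol: "ortholattice L0" and normal: "L0 \<unlhd> L1" and dual: "dual_copy_map L0 L1 \<iota>"
begin

abbreviation "C0 \<equiv> carrier L0"
abbreviation "C1 \<equiv> carrier L1"
abbreviation "G \<equiv> ortho_glue L1 \<iota>"
abbreviation compl0 where "compl0 x \<equiv> x\<^sup>\<bottom>\<^bsub>L0\<^esub>"
abbreviation le1 (infix \<open>\<preceq>\<close> 50) where "x \<preceq> y \<equiv> x \<sqsubseteq>\<^bsub>L1\<^esub> y"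
abbreviation leG (infix \<open>\<preceq>\<^sub>G\<close> 50) where "x \<preceq>\<^sub>G y \<equiv> x \<sqsubseteq>\<^bsub>G\<^esub> y"

definition core :: "'a \<Rightarrow> 'a" where
  "core x = (SOME g. greatest L1 g {z \<in> C0. z \<preceq> x})"

lemma bounded1: "bounded_lattice L1" and sub: "C0 \<subseteq> C1"
  and le01: "\<lbrakk>x \<in> C0; y \<in> C0\<rbrakk> \<Longrightarrow> x \<sqsubseteq>\<^bsub>L0\<^esub> y \<longleftrightarrow> x \<preceq> y"
  and join01: "\<lbrakk>x \<in> C0; y \<in> C0\<rbrakk> \<Longrightarrow> x \<squnion>\<^bsub>L0\<^esub> y = x \<squnion>\<^bsub>L1\<^esub> y"
  and meet01: "\<lbrakk>x \<in> C0; y \<in> C0\<rbrakk> \<Longrightarrow> x \<sqinter>\<^bsub>L0\<^esub> y = x \<sqinter>\<^bsub>L1\<^esub> y"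
  and bot01: "\<bottom>\<^bsub>L0\<^esub> = \<bottom>\<^bsub>L1\<^esub>" and top01: "\<top>\<^bsub>L0\<^esub> = \<top>\<^bsub>L1\<^esub>"
  and down: "\<lbrakk>x \<preceq> z; z \<in> C0; z \<noteq> \<top>\<^bsub>L1\<^esub>; x \<in> C1\<rbrakk> \<Longrightarrow> x \<in> C0"
proof -
  have b: "bounded_sublattice L0 L1"
    using normal by (simp add: normal_sublattice_def)
  show "bounded_lattice L1" "C0 \<subseteq> C1" "\<bottom>\<^bsub>L0\<^esub> = \<bottom>\<^bsub>L1\<^esub>" "\<top>\<^bsub>L0\<^esub> = \<top>\<^bsub>L1\<^esub>"
    using b by (simp_all only: bounded_sublattice_def)
  show "\<lbrakk>x \<in> C0; y \<in> C0\<rbrakk> \<Longrightarrow> x \<sqsubseteq>\<^bsub>L0\<^esub> y \<longleftrightarrow> x \<preceq> y"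
    "\<lbrakk>x \<in> C0; y \<in> C0\<rbrakk> \<Longrightarrow> x \<squnion>\<^bsub>L0\<^esub> y = x \<squnion>\<^bsub>L1\<^esub> y"
    "\<lbrakk>x \<in> C0; y \<in> C0\<rbrakk> \<Longrightarrow> x \<sqinter>\<^bsub>L0\<^esub> y = x \<sqinter>\<^bsub>L1\<^esub> y"
    using b unfolding bounded_sublattice_def by blast+
  show "\<lbrakk>x \<preceq> z; z \<in> C0; z \<noteq> \<top>\<^bsub>L1\<^esub>; x \<in> C1\<rbrakk> \<Longrightarrow> x \<in> C0"
    using normal unfolding normal_sublattice_def by blast
qed

lemma refl1: "x \<in> C1 \<Longrightarrow> x \<preceq> x"
  and trans1: "\<lbrakk>x \<preceq> y; y \<preceq> z; x \<in> C1; y \<in> C1; z \<in> C1\<rbrakk> \<Longrightarrow> x \<preceq> z"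
  and antisym1: "\<lbrakk>x \<preceq> y; y \<preceq> x; x \<in> C1; y \<in> C1\<rbrakk> \<Longrightarrow> x = y"
  and join1: "\<lbrakk>x \<in> C1; y \<in> C1\<rbrakk> \<Longrightarrow> x \<squnion>\<^bsub>L1\<^esub> y \<in> C1"
    "\<lbrakk>x \<in> C1; y \<in> C1\<rbrakk> \<Longrightarrow> x \<preceq> x \<squnion>\<^bsub>L1\<^esub> y" "\<lbrakk>x \<in> C1; y \<in> C1\<rbrakk> \<Longrightarrow> y \<preceq> x \<squnion>\<^bsub>L1\<^esub> y"
    "\<lbrakk>x \<preceq> z; y \<preceq> z; x \<in> C1; y \<in> C1; z \<in> C1\<rbrakk> \<Longrightarrow> x \<squnion>\<^bsub>L1\<^esub> y \<preceq> z"
  and meet1: "\<lbrakk>x \<in> C1; y \<in> C1\<rbrakk> \<Longrightarrow> x \<sqinter>\<^bsub>L1\<^esub> y \<in> C1"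
    "\<lbrakk>x \<in> C1; y \<in> C1\<rbrakk> \<Longrightarrow> x \<sqinter>\<^bsub>L1\<^esub> y \<preceq> x" "\<lbrakk>x \<in> C1; y \<in> C1\<rbrakk> \<Longrightarrow> x \<sqinter>\<^bsub>L1\<^esub> y \<preceq> y"
    "\<lbrakk>z \<preceq> x; z \<preceq> y; x \<in> C1; y \<in> C1; z \<in> C1\<rbrakk> \<Longrightarrow> z \<preceq> x \<sqinter>\<^bsub>L1\<^esub> y"
  and top1: "x \<in> C1 \<Longrightarrow> x \<preceq> \<top>\<^bsub>L1\<^esub>" and bot1: "x \<in> C1 \<Longrightarrow> \<bottom>\<^bsub>L1\<^esub> \<preceq> x"
proof -
  interpret L1: bounded_lattice L1 by (rule bounded1)
  show "x \<in> C1 \<Longrightarrow> x \<preceq> x"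
    "\<lbrakk>x \<preceq> y; y \<preceq> z; x \<in> C1; y \<in> C1; z \<in> C1\<rbrakk> \<Longrightarrow> x \<preceq> z"
    "\<lbrakk>x \<preceq> y; y \<preceq> x; x \<in> C1; y \<in> C1\<rbrakk> \<Longrightarrow> x = y"
    "\<lbrakk>x \<in> C1; y \<in> C1\<rbrakk> \<Longrightarrow> x \<squnion>\<^bsub>L1\<^esub> y \<in> C1"
    "\<lbrakk>x \<in> C1; y \<in> C1\<rbrakk> \<Longrightarrow> x \<preceq> x \<squnion>\<^bsub>L1\<^esub> y" "\<lbrakk>x \<in> C1; y \<in> C1\<rbrakk> \<Longrightarrow> y \<preceq> x \<squnion>\<^bsub>L1\<^esub> y"
    "\<lbrakk>x \<preceq> z; y \<preceq> z; x \<in> C1; y \<in> C1; z \<in> C1\<rbrakk> \<Longrightarrow> x \<squnion>\<^bsub>L1\<^esub> y \<preceq> z"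
    "\<lbrakk>x \<in> C1; y \<in> C1\<rbrakk> \<Longrightarrow> x \<sqinter>\<^bsub>L1\<^esub> y \<in> C1"
    "\<lbrakk>x \<in> C1; y \<in> C1\<rbrakk> \<Longrightarrow> x \<sqinter>\<^bsub>L1\<^esub> y \<preceq> x" "\<lbrakk>x \<in> C1; y \<in> C1\<rbrakk> \<Longrightarrow> x \<sqinter>\<^bsub>L1\<^esub> y \<preceq> y"
    "\<lbrakk>z \<preceq> x; z \<preceq> y; x \<in> C1; y \<in> C1; z \<in> C1\<rbrakk> \<Longrightarrow> z \<preceq> x \<sqinter>\<^bsub>L1\<^esub> y"
    "x \<in> C1 \<Longrightarrow> x \<preceq> \<top>\<^bsub>L1\<^esub>" "x \<in> C1 \<Longrightarrow> \<bottom>\<^bsub>L1\<^esub> \<preceq> x"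
    by (fact L1.le_refl L1.le_trans L1.le_antisym L1.join_closed L1.join_left L1.join_right
        L1.join_le L1.meet_closed L1.meet_left L1.meet_right L1.meet_le
        L1.top_higher L1.bottom_lower)+
qed

lemma compl0_closed: "z \<in> C0 \<Longrightarrow> compl0 z \<in> C0"
  and compl0_antitone: "\<lbrakk>z \<preceq> z'; z \<in> C0; z' \<in> C0\<rbrakk> \<Longrightarrow> compl0 z' \<preceq> compl0 z"
  and compl0_compl0: "z \<in> C0 \<Longrightarrow> compl0 (compl0 z) = z"
  and compl0_join: "z \<in> C0 \<Longrightarrow> z \<squnion>\<^bsub>L1\<^esub> compl0 z = \<top>\<^bsub>L1\<^esub>"
  and join_closed0: "\<lbrakk>z \<in> C0; z' \<in> C0\<rbrakk> \<Longrightarrow> z \<squnion>\<^bsub>L1\<^esub> z' \<in> C0"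
  and meet_closed0: "\<lbrakk>z \<in> C0; z' \<in> C0\<rbrakk> \<Longrightarrow> z \<sqinter>\<^bsub>L1\<^esub> z' \<in> C0"
  and top0: "\<top>\<^bsub>L1\<^esub> \<in> C0" and bot0: "\<bottom>\<^bsub>L1\<^esub> \<in> C0"
proof -
  interpret L0: ortholattice L0 by (rule ol)
  show "z \<in> C0 \<Longrightarrow> compl0 z \<in> C0" by (rule L0.ocompl_closed)
  show "\<lbrakk>z \<preceq> z'; z \<in> C0; z' \<in> C0\<rbrakk> \<Longrightarrow> compl0 z' \<preceq> compl0 z"
    using L0.ocompl_antitone[of z z'] by (simp add: le01 L0.ocompl_closed)
  show "z \<in> C0 \<Longrightarrow> compl0 (compl0 z) = z" by (rule L0.ocompl_involutive)
  show "z \<in> C0 \<Longrightarrow> z \<squnion>\<^bsub>L1\<^esub> compl0 z = \<top>\<^bsub>L1\<^esub>"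
    using L0.join_ocompl[of z] by (simp add: join01 top01 L0.ocompl_closed)
  show "\<lbrakk>z \<in> C0; z' \<in> C0\<rbrakk> \<Longrightarrow> z \<squnion>\<^bsub>L1\<^esub> z' \<in> C0"
    using L0.join_closed[of z z'] by (simp add: join01)
  show "\<lbrakk>z \<in> C0; z' \<in> C0\<rbrakk> \<Longrightarrow> z \<sqinter>\<^bsub>L1\<^esub> z' \<in> C0"
    using L0.meet_closed[of z z'] by (simp add: meet01)
  show "\<top>\<^bsub>L1\<^esub> \<in> C0" "\<bottom>\<^bsub>L1\<^esub> \<in> C0"
    using L0.top_closed L0.bottom_closed by (simp_all add: top01 bot01)
qed

lemma in1: "z \<in> C0 \<Longrightarrow> z \<in> C1"
  using sub by blast

lemma core_greatest: "x \<in> C1 \<Longrightarrow> greatest L1 (core x) {z \<in> C0. z \<preceq> x}"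
proof -
  assume "x \<in> C1"
  then have "\<exists>g. greatest L1 g {z \<in> C0. z \<preceq> x}"
    using normal unfolding normal_sublattice_def by blast
  then show ?thesis
    unfolding core_def by (rule someI_ex)
qed

lemma core_closed: "x \<in> C1 \<Longrightarrow> core x \<in> C0"
  and core_below: "x \<in> C1 \<Longrightarrow> core x \<preceq> x"
  and core_max: "\<lbrakk>z \<preceq> x; z \<in> C0; x \<in> C1\<rbrakk> \<Longrightarrow> z \<preceq> core x"
  using core_greatest[of x] by (simp_all add: greatest_def)

lemma core_eqI:
  "\<lbrakk>x \<in> C1; g \<in> C0; g \<preceq> x; \<And>z. \<lbrakk>z \<in> C0; z \<preceq> x\<rbrakk> \<Longrightarrow> z \<preceq> g\<rbrakk> \<Longrightarrow> core x = g"
  by (meson antisym1 core_below core_closed core_max in1)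

lemma inj_iota: "inj_on \<iota> C1"
  and iota0: "z \<in> C0 \<Longrightarrow> \<iota> z = compl0 z"
  and overlap: "C1 \<inter> \<iota> ` C1 = C0"
  using dual unfolding dual_copy_map_def by blast+

lemma iota_eq_iff: "\<lbrakk>x \<in> C1; y \<in> C1\<rbrakk> \<Longrightarrow> \<iota> x = \<iota> y \<longleftrightarrow> x = y"
  using inj_iota by (simp add: inj_on_eq_iff)

text \<open>An element of both copies lies in \<open>L0\<close>, so its preimage under \<open>\<iota>\<close> is its orthocomplement. All
compatibility checks between the two orders reduce to this.\<close>

lemma overlapD: "\<lbrakk>\<iota> x \<in> C1; x \<in> C1\<rbrakk> \<Longrightarrow> x \<in> C0"
  by (metis IntI compl0_closed compl0_compl0 imageI in1 iota0 iota_eq_iff overlap)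

lemma iota_overlapD: "\<lbrakk>\<iota> x \<in> C1; x \<in> C1\<rbrakk> \<Longrightarrow> \<iota> x \<in> C0 \<and> x = compl0 (\<iota> x)"
  by (metis compl0_closed compl0_compl0 overlapD iota0)

lemma carrierG: "carrier G = C1 \<union> \<iota> ` C1"
  by (simp add: ortho_glue_def)

lemma carrierG_cases:
  assumes "u \<in> carrier G"
  obtains "u \<in> C1" | x where "x \<in> C1" "u = \<iota> x"
  using assms by (auto simp: carrierG)

definition base :: "('a \<times> 'a) set" where
  "base = {(x, y). x \<in> C1 \<and> y \<in> C1 \<and> x \<preceq> y} \<union>
     {(\<iota> x, \<iota> y) | x y. x \<in> C1 \<and> y \<in> C1 \<and> y \<preceq> x}"

lemma leG_trancl: "u \<preceq>\<^sub>G v \<longleftrightarrow> (u, v) \<in> base\<^sup>+"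
  by (simp add: ortho_glue_def base_def)

text \<open>A composite of steps in the two orders changes copies only inside \<open>L0\<close>, where both orders agree;
hence one change is enough, and the transitive closure has this explicit form.\<close>

inductive glued :: "'a \<Rightarrow> 'a \<Rightarrow> bool" where
  glued11: "\<lbrakk>u \<in> C1; v \<in> C1; u \<preceq> v\<rbrakk> \<Longrightarrow> glued u v"
| glued22: "\<lbrakk>x \<in> C1; y \<in> C1; y \<preceq> x\<rbrakk> \<Longrightarrow> glued (\<iota> x) (\<iota> y)"
| glued12: "\<lbrakk>u \<in> C1; z \<in> C0; y \<in> C1; u \<preceq> z; y \<preceq> compl0 z\<rbrakk> \<Longrightarrow> glued u (\<iota> y)"
| glued21: "\<lbrakk>x \<in> C1; z \<in> C0; v \<in> C1; compl0 z \<preceq> x; z \<preceq> v\<rbrakk> \<Longrightarrow> glued (\<iota> x) v"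

lemma glued_step:
  assumes "glued u v" "(v, w) \<in> base"
  shows "glued u w"
proof -
  consider "v \<in> C1" "w \<in> C1" "v \<preceq> w"
    | y w' where "v = \<iota> y" "w = \<iota> w'" "y \<in> C1" "w' \<in> C1" "w' \<preceq> y"
    using assms(2) by (auto simp: base_def)
  then show ?thesis
  proof cases
    case 1
    from assms(1) show ?thesis
    proof cases
      case glued11
      with 1 show ?thesis by (meson trans1 glued.glued11)
    next
      case (glued22 x y)
      with 1 have "v \<in> C0" "y = compl0 v" using iota_overlapD by simp_all
      with glued22 1 show ?thesis by (metis glued.glued21)
    next
      case (glued12 z y)
      with 1 have v: "v \<in> C0" "y = compl0 v" using iota_overlapD by simp_all
      with glued12 have "z \<preceq> v" using compl0_antitone[of y "compl0 z"]
        by (simp add: compl0_closed compl0_compl0)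
      with v glued12 1 have "u \<preceq> w" by (meson trans1 in1)
      with glued12 1 show ?thesis by (metis glued.glued11)
    next
      case (glued21 x z)
      with 1 have "z \<preceq> w" by (meson trans1 in1)
      with glued21 1 show ?thesis by (metis glued.glued21)
    qed
  next
    case 2
    from assms(1) show ?thesis
    proof cases
      case glued11
      with 2 have "v \<in> C0" "y = compl0 v" using iota_overlapD by simp_all
      with glued11 2 show ?thesis by (metis glued.glued12)
    next
      case (glued22 x y')
      with 2 have "y' = y" using iota_eq_iff by simp
      with glued22 2 have "w' \<preceq> x" by (meson trans1)
      with glued22 2 show ?thesis by (metis glued.glued22)
    next
      case (glued12 z y')
      with 2 have "y' = y" using iota_eq_iff by simp
      with glued12 2 have "w' \<preceq> compl0 z" by (meson trans1 in1 compl0_closed)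
      with glued12 2 show ?thesis by (metis glued.glued12)
    next
      case (glued21 x z)
      with 2 have v: "v \<in> C0" "y = compl0 v" using iota_overlapD by simp_all
      with glued21 have "compl0 v \<preceq> compl0 z" by (simp add: compl0_antitone)
      with v glued21 2 have "w' \<preceq> x" by (meson trans1 in1 compl0_closed)
      with glued21 2 show ?thesis by (metis glued.glued22)
    qed
  qed
qed

lemma leG_glued: "u \<preceq>\<^sub>G v \<longleftrightarrow> glued u v"
proof
  assume "u \<preceq>\<^sub>G v"
  then have "(u, v) \<in> base\<^sup>+" by (simp add: leG_trancl)
  then show "glued u v"
  proof (induction rule: trancl_induct)
    case (base y)
    then show ?case unfolding base_def by (auto intro: glued11 glued22)
  next
    case (step y z)
    then show ?case by (blast intro: glued_step)
  qed
next
  have base1: "(x, y) \<in> base" if "x \<in> C1" "y \<in> C1" "x \<preceq> y" for x y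
    using that by (simp add: base_def)
  have base2: "(\<iota> x, \<iota> y) \<in> base" if "x \<in> C1" "y \<in> C1" "y \<preceq> x" for x y
    using that unfolding base_def by blast
  assume "glued u v"
  then have "(u, v) \<in> base\<^sup>+"
  proof cases
    case (glued12 z y)
    then have "(u, z) \<in> base" "(\<iota> (compl0 z), v) \<in> base"
      by (simp_all add: base1 base2 in1 compl0_closed)
    then show ?thesis using glued12 by (simp add: iota0 compl0_closed compl0_compl0)
  next
    case (glued21 x z)
    then have "(z, v) \<in> base" "(u, \<iota> (compl0 z)) \<in> base"
      by (simp_all add: base1 base2 in1 compl0_closed)
    then show ?thesis using glued21 by (simp add: iota0 compl0_closed compl0_compl0)
  qed (simp_all add: base1 base2 r_into_trancl)
  then show "u \<preceq>\<^sub>G v" by (simp add: leG_trancl)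
qed

lemma le11:
  assumes uv: "u \<in> C1" "v \<in> C1"
  shows "u \<preceq>\<^sub>G v \<longleftrightarrow> u \<preceq> v"
proof
  assume "u \<preceq>\<^sub>G v"
  then have "glued u v" by (simp add: leG_glued)
  then show "u \<preceq> v"
  proof cases
    case (glued22 x y)
    with uv have "x = compl0 u" "y = compl0 v" "u \<in> C0" "v \<in> C0" using iota_overlapD by simp_all
    with glued22 show ?thesis using compl0_antitone[of y x] by (simp add: compl0_closed compl0_compl0)
  next
    case (glued12 z y)
    with uv have v: "y = compl0 v" "v \<in> C0" using iota_overlapD by simp_all
    with glued12 have "z \<preceq> v" using compl0_antitone[of y "compl0 z"]
      by (simp add: compl0_closed compl0_compl0)
    with glued12 v uv show ?thesis by (meson trans1 in1)
  next
    case (glued21 x z)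
    with uv have v: "x = compl0 u" "u \<in> C0" using iota_overlapD by simp_all
    with glued21 have "u \<preceq> z" using compl0_antitone[of "compl0 z" x]
      by (simp add: compl0_closed compl0_compl0)
    with glued21 v uv show ?thesis by (meson trans1 in1)
  qed
qed (simp add: leG_glued glued11 uv)

lemma le12:
  assumes "u \<in> C1" "y \<in> C1"
  shows "u \<preceq>\<^sub>G \<iota> y \<longleftrightarrow> (\<exists>z\<in>C0. u \<preceq> z \<and> y \<preceq> compl0 z)"
proof
  assume "u \<preceq>\<^sub>G \<iota> y"
  then have "glued u (\<iota> y)" by (simp add: leG_glued)
  then show "\<exists>z\<in>C0. u \<preceq> z \<and> y \<preceq> compl0 z"
  proof cases
    case glued11
    with assms have "\<iota> y \<in> C0" "y = compl0 (\<iota> y)" using iota_overlapD by blast+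
    with glued11 assms show ?thesis by (metis refl1)
  next
    case (glued22 x y')
    with assms have "u \<in> C0" "x = compl0 u" "y' = y"
      using iota_overlapD iota_eq_iff by simp_all
    with glued22 assms show ?thesis by (metis refl1)
  next
    case (glued12 z y')
    with assms show ?thesis using iota_eq_iff by auto
  next
    case (glued21 x z)
    with assms have *: "\<iota> y \<in> C0" "y = compl0 (\<iota> y)" "u \<in> C0" "x = compl0 u"
      using iota_overlapD by simp_all
    with glued21 have "u \<preceq> z" using compl0_antitone[of "compl0 z" x]
      by (simp add: compl0_closed compl0_compl0)
    with * glued21 assms show ?thesis by (metis refl1 trans1 in1)
  qed
qed (auto simp: leG_glued intro: glued12 assms)

lemma le22:
  assumes "x \<in> C1" "y \<in> C1"
  shows "\<iota> x \<preceq>\<^sub>G \<iota> y \<longleftrightarrow> y \<preceq> x"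
proof
  assume "\<iota> x \<preceq>\<^sub>G \<iota> y"
  then have "glued (\<iota> x) (\<iota> y)" by (simp add: leG_glued)
  then show "y \<preceq> x"
  proof cases
    case glued11
    with assms have "x = compl0 (\<iota> x)" "y = compl0 (\<iota> y)" "\<iota> x \<in> C0" "\<iota> y \<in> C0"
      using iota_overlapD by blast+
    with glued11 show ?thesis by (metis compl0_antitone)
  next
    case (glued22 x' y')
    with assms show ?thesis using iota_eq_iff by simp
  next
    case (glued12 z y')
    with assms have *: "\<iota> x \<in> C0" "x = compl0 (\<iota> x)" "y' = y"
      using iota_overlapD iota_eq_iff by simp_all
    with glued12 have "compl0 z \<preceq> x" by (metis compl0_antitone)
    with * glued12 assms show ?thesis by (metis trans1 in1 compl0_closed)
  next
    case (glued21 x' z)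
    with assms have *: "\<iota> y \<in> C0" "y = compl0 (\<iota> y)" "x' = x"
      using iota_overlapD iota_eq_iff by simp_all
    with glued21 have "y \<preceq> compl0 z" by (metis compl0_antitone)
    with * glued21 assms show ?thesis by (metis trans1 in1 compl0_closed)
  qed
qed (simp add: leG_glued glued22 assms)

lemma le21:
  assumes "x \<in> C1" "v \<in> C1"
  shows "\<iota> x \<preceq>\<^sub>G v \<longleftrightarrow> (\<exists>z\<in>C0. compl0 z \<preceq> x \<and> z \<preceq> v)"
proof
  assume "\<iota> x \<preceq>\<^sub>G v"
  then have "glued (\<iota> x) v" by (simp add: leG_glued)
  then show "\<exists>z\<in>C0. compl0 z \<preceq> x \<and> z \<preceq> v"
  proof cases
    case glued11
    with assms have "\<iota> x \<in> C0" "x = compl0 (\<iota> x)" using iota_overlapD by blast+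
    with glued11 assms show ?thesis by (metis refl1)
  next
    case (glued22 x' y)
    with assms have "v \<in> C0" "y = compl0 v" "x' = x"
      using iota_overlapD iota_eq_iff by simp_all
    with glued22 assms show ?thesis by (metis refl1)
  next
    case (glued12 z y)
    with assms have *: "\<iota> x \<in> C0" "x = compl0 (\<iota> x)" "v \<in> C0" "y = compl0 v"
      using iota_overlapD by simp_all
    with glued12 have "z \<preceq> v" using compl0_antitone[of y "compl0 z"]
      by (simp add: compl0_closed compl0_compl0)
    with * glued12 assms show ?thesis by (metis refl1 trans1 in1)
  next
    case (glued21 x' z)
    with assms show ?thesis using iota_eq_iff by auto
  qed
qed (auto simp: leG_glued intro: glued21 assms)

lemma partial_order_G: "partial_order G"
proof (rule partial_orderI)
  show "eq G = (=)" by (simp add: ortho_glue_def)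
next
  fix u assume "u \<in> carrier G"
  then show "u \<preceq>\<^sub>G u"
    by (cases rule: carrierG_cases) (simp_all add: le11 le22 refl1)
next
  fix u v w assume "u \<preceq>\<^sub>G v" "v \<preceq>\<^sub>G w"
  then show "u \<preceq>\<^sub>G w" unfolding leG_trancl by (rule trancl_trans)
next
  have mixed: "u = \<iota> y" if "u \<in> C1" "y \<in> C1" "u \<preceq>\<^sub>G \<iota> y" "\<iota> y \<preceq>\<^sub>G u" for u y
  proof -
    from that obtain z z' where z: "z \<in> C0" "u \<preceq> z" "y \<preceq> compl0 z"
      and z': "z' \<in> C0" "compl0 z' \<preceq> y" "z' \<preceq> u"
      by (auto simp: le12 le21)
    from z z' that have "compl0 z' \<preceq> compl0 z" by (meson trans1 in1 compl0_closed)
    then have "z \<preceq> z'" using z z' compl0_antitone[of "compl0 z'" "compl0 z"]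
      by (simp add: compl0_closed compl0_compl0)
    moreover have "z' \<preceq> z" using z z' that by (meson trans1 in1)
    ultimately have "z' = z" using z z' by (meson antisym1 in1)
    with z z' that have "u = z" "y = compl0 z" by (simp_all add: antisym1 in1 compl0_closed)
    with z show ?thesis by (simp add: iota0 compl0_closed compl0_compl0)
  qed
  fix u v assume "u \<in> carrier G" "v \<in> carrier G" and uv: "u \<preceq>\<^sub>G v" "v \<preceq>\<^sub>G u"
  then consider "u \<in> C1" "v \<in> C1" | y where "u \<in> C1" "y \<in> C1" "v = \<iota> y"
    | x where "x \<in> C1" "u = \<iota> x" "v \<in> C1" | x y where "x \<in> C1" "y \<in> C1" "u = \<iota> x" "v = \<iota> y"
    by (auto simp: carrierG)
  then show "u = v"
  proof cases
    case 1 with uv show ?thesis by (simp add: le11 antisym1)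
  next
    case 2 with uv mixed show ?thesis by simp
  next
    case 3 with uv mixed[of v x] show ?thesis by simp
  next
    case 4
    with uv have "x = y" by (simp add: le22 antisym1)
    with 4 show ?thesis by simp
  qed
qed

abbreviation complG where "complG u \<equiv> u\<^sup>\<bottom>\<^bsub>G\<^esub>"

lemma complG1: "x \<in> C1 \<Longrightarrow> complG x = \<iota> x"
  by (simp add: ortho_glue_def)

lemma complG_iota: "x \<in> C1 \<Longrightarrow> complG (\<iota> x) = x"
proof (cases "\<iota> x \<in> C1")
  case True
  moreover assume "x \<in> C1"
  ultimately have "\<iota> x \<in> C0" "x = compl0 (\<iota> x)" using iota_overlapD by blast+
  with True show ?thesis by (simp add: complG1 iota0)
next
  case False
  moreover assume "x \<in> C1"
  ultimately show ?thesis by (simp add: ortho_glue_def inv_into_f_f inj_iota)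
qed

lemma complG_closed: "u \<in> carrier G \<Longrightarrow> complG u \<in> carrier G"
  by (erule carrierG_cases) (simp_all add: complG1 complG_iota carrierG)

lemma complG_complG: "u \<in> carrier G \<Longrightarrow> complG (complG u) = u"
  by (erule carrierG_cases) (simp_all add: complG1 complG_iota)

lemma complG_antitone:
  assumes "u \<in> carrier G" "v \<in> carrier G" "u \<preceq>\<^sub>G v"
  shows "complG v \<preceq>\<^sub>G complG u"
proof -
  from assms consider "u \<in> C1" "v \<in> C1" | y where "u \<in> C1" "y \<in> C1" "v = \<iota> y"
    | x where "x \<in> C1" "u = \<iota> x" "v \<in> C1" | x y where "x \<in> C1" "y \<in> C1" "u = \<iota> x" "v = \<iota> y"
    by (auto simp: carrierG)
  then show ?thesis
  proof cases
    case 1 with assms show ?thesis by (simp add: le11 le22 complG1)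
  next
    case 2
    with assms obtain z where "z \<in> C0" "u \<preceq> z" "y \<preceq> compl0 z" by (auto simp: le12)
    then have "\<exists>z\<in>C0. y \<preceq> z \<and> u \<preceq> compl0 z"
      by (intro bexI[of _ "compl0 z"]) (simp_all add: compl0_compl0 compl0_closed)
    with 2 show ?thesis by (simp add: complG1 complG_iota le12)
  next
    case 3
    with assms obtain z where "z \<in> C0" "compl0 z \<preceq> x" "z \<preceq> v" by (auto simp: le21)
    then have "\<exists>z\<in>C0. compl0 z \<preceq> v \<and> z \<preceq> x"
      by (intro bexI[of _ "compl0 z"]) (simp_all add: compl0_compl0 compl0_closed)
    with 3 show ?thesis by (simp add: complG1 complG_iota le21)
  next
    case 4 with assms show ?thesis by (simp add: le11 le22 complG_iota)
  qed
qed

lemma complG_le_iff: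
  "\<lbrakk>u \<in> carrier G; v \<in> carrier G\<rbrakk> \<Longrightarrow> complG v \<preceq>\<^sub>G complG u \<longleftrightarrow> u \<preceq>\<^sub>G v"
  by (metis complG_antitone complG_closed complG_complG)

text \<open>Joins and meets are first treated as relations, because \<open>\<squnion>\<close> and \<open>\<sqinter>\<close> of the glued order are
informative only once suprema and infima are known to exist.\<close>

definition join_is :: "'a \<Rightarrow> 'a \<Rightarrow> 'a \<Rightarrow> bool" where
  "join_is u v s \<longleftrightarrow> s \<in> carrier G \<and> u \<preceq>\<^sub>G s \<and> v \<preceq>\<^sub>G s \<and>
     (\<forall>t\<in>carrier G. u \<preceq>\<^sub>G t \<and> v \<preceq>\<^sub>G t \<longrightarrow> s \<preceq>\<^sub>G t)"

definition meet_is :: "'a \<Rightarrow> 'a \<Rightarrow> 'a \<Rightarrow> bool" where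
  "meet_is u v i \<longleftrightarrow> i \<in> carrier G \<and> i \<preceq>\<^sub>G u \<and> i \<preceq>\<^sub>G v \<and>
     (\<forall>t\<in>carrier G. t \<preceq>\<^sub>G u \<and> t \<preceq>\<^sub>G v \<longrightarrow> t \<preceq>\<^sub>G i)"

text \<open>Complementation is an order-reversing bijection of the glued order, so it exchanges joins and meets.
Only joins inside \<open>L1\<close>, meets inside \<open>L1\<close> and mixed joins have to be found directly.\<close>

lemma join_is_compl:
  assumes "meet_is (complG u) (complG v) i" "u \<in> carrier G" "v \<in> carrier G"
  shows "join_is u v (complG i)"
proof -
  have i: "i \<in> carrier G" using assms by (simp add: meet_is_def)
  have "u \<preceq>\<^sub>G complG i \<longleftrightarrow> i \<preceq>\<^sub>G complG u" "v \<preceq>\<^sub>G complG i \<longleftrightarrow> i \<preceq>\<^sub>G complG v"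
    using complG_le_iff[of u "complG i"] complG_le_iff[of v "complG i"] assms i
    by (simp_all add: complG_closed complG_complG)
  moreover have "complG i \<preceq>\<^sub>G t" if "t \<in> carrier G" "u \<preceq>\<^sub>G t" "v \<preceq>\<^sub>G t" for t
  proof -
    have "complG t \<preceq>\<^sub>G i"
      using assms that by (simp add: meet_is_def complG_closed complG_le_iff)
    with that i show ?thesis
      using complG_antitone[of "complG t" i] by (simp add: complG_closed complG_complG)
  qed
  ultimately show ?thesis
    using assms by (simp add: join_is_def meet_is_def complG_closed)
qed

lemma meet_is_compl:
  assumes "join_is (complG u) (complG v) s" "u \<in> carrier G" "v \<in> carrier G"
  shows "meet_is u v (complG s)"
proof -
  have s: "s \<in> carrier G" using assms by (simp add: join_is_def)
  have "complG s \<preceq>\<^sub>G u \<longleftrightarrow> complG u \<preceq>\<^sub>G s" "complG s \<preceq>\<^sub>G v \<longleftrightarrow> complG v \<preceq>\<^sub>G s"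
    using complG_le_iff[of "complG s" u] complG_le_iff[of "complG s" v] assms s
    by (simp_all add: complG_closed complG_complG)
  moreover have "t \<preceq>\<^sub>G complG s" if "t \<in> carrier G" "t \<preceq>\<^sub>G u" "t \<preceq>\<^sub>G v" for t
  proof -
    have "s \<preceq>\<^sub>G complG t"
      using assms that by (simp add: join_is_def complG_closed complG_le_iff)
    with that s show ?thesis
      using complG_antitone[of s "complG t"] by (simp add: complG_closed complG_complG)
  qed
  ultimately show ?thesis
    using assms by (simp add: meet_is_def join_is_def complG_closed)
qed

text \<open>An upper bound \<open>\<iota> w\<close> of \<open>u\<close> and \<open>v\<close> in the dual copy lies above elements \<open>z, z'\<close> of \<open>L0\<close> that
are themselves above \<open>u\<close> and \<open>v\<close>; then \<open>z \<squnion> z'\<close> also separates \<open>u \<squnion> v\<close> from \<open>\<iota> w\<close>. So \<open>L1\<close> is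
closed under joins, and by the analogous argument below under meets.\<close>

lemma join_is11:
  assumes uv: "u \<in> C1" "v \<in> C1"
  shows "join_is u v (u \<squnion>\<^bsub>L1\<^esub> v)"
proof -
  have "u \<squnion>\<^bsub>L1\<^esub> v \<preceq>\<^sub>G t" if "t \<in> carrier G" "u \<preceq>\<^sub>G t" "v \<preceq>\<^sub>G t" for t
    using that(1)
  proof (cases rule: carrierG_cases)
    case 1 with that uv show ?thesis by (simp add: le11 join1)
  next
    case (2 w)
    with that uv obtain z z' where z: "z \<in> C0" "u \<preceq> z" "w \<preceq> compl0 z"
      and z': "z' \<in> C0" "v \<preceq> z'" "w \<preceq> compl0 z'"
      by (auto simp: le12)
    let ?z = "z \<squnion>\<^bsub>L1\<^esub> z'" and ?w = "compl0 z \<sqinter>\<^bsub>L1\<^esub> compl0 z'"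
    have "z \<preceq> compl0 ?w" "z' \<preceq> compl0 ?w"
      using z z' compl0_antitone[of ?w "compl0 z"] compl0_antitone[of ?w "compl0 z'"]
      by (simp_all add: meet1 compl0_closed compl0_compl0 meet_closed0 in1)
    then have "?z \<preceq> compl0 ?w"
      using z z' by (simp add: join1 compl0_closed meet_closed0 in1)
    then have "?w \<preceq> compl0 ?z"
      using z z' compl0_antitone[of ?z "compl0 ?w"]
      by (simp add: compl0_closed compl0_compl0 meet_closed0 join_closed0)
    moreover have "w \<preceq> ?w" using z z' 2 by (simp add: meet1 compl0_closed in1)
    ultimately have "w \<preceq> compl0 ?z"
      using trans1[of w ?w "compl0 ?z"] z z' 2
      by (simp add: compl0_closed join_closed0 meet_closed0 in1)
    moreover have "u \<preceq> ?z" "v \<preceq> ?z"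
      using z z' uv by (meson trans1 in1 join1)+
    then have "u \<squnion>\<^bsub>L1\<^esub> v \<preceq> ?z"
      using z z' uv by (simp add: join1 in1)
    moreover have "?z \<in> C0" using z z' by (simp add: join_closed0)
    ultimately show ?thesis
      using 2 uv by (auto simp: le12 join1(1))
  qed
  then show ?thesis
    using uv by (simp add: join_is_def carrierG join1 le11)
qed

lemma meet_is11:
  assumes uv: "u \<in> C1" "v \<in> C1"
  shows "meet_is u v (u \<sqinter>\<^bsub>L1\<^esub> v)"
proof -
  have "t \<preceq>\<^sub>G u \<sqinter>\<^bsub>L1\<^esub> v" if "t \<in> carrier G" "t \<preceq>\<^sub>G u" "t \<preceq>\<^sub>G v" for t
    using that(1)
  proof (cases rule: carrierG_cases)
    case 1 with that uv show ?thesis by (simp add: le11 meet1)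
  next
    case (2 w)
    with that uv obtain z z' where z: "z \<in> C0" "compl0 z \<preceq> w" "z \<preceq> u"
      and z': "z' \<in> C0" "compl0 z' \<preceq> w" "z' \<preceq> v"
      by (auto simp: le21)
    let ?z = "z \<sqinter>\<^bsub>L1\<^esub> z'" and ?w = "compl0 z \<squnion>\<^bsub>L1\<^esub> compl0 z'"
    have "compl0 ?w \<preceq> z" "compl0 ?w \<preceq> z'"
      using z z' compl0_antitone[of "compl0 z" ?w] compl0_antitone[of "compl0 z'" ?w]
      by (simp_all add: join1 compl0_closed compl0_compl0 join_closed0 in1)
    then have "compl0 ?w \<preceq> ?z"
      using z z' by (simp add: meet1 compl0_closed join_closed0 in1)
    then have "compl0 ?z \<preceq> ?w"
      using z z' compl0_antitone[of "compl0 ?w" ?z]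
      by (simp add: compl0_closed compl0_compl0 meet_closed0 join_closed0)
    moreover have "?w \<preceq> w" using z z' 2 by (simp add: join1 compl0_closed in1)
    ultimately have "compl0 ?z \<preceq> w"
      using trans1[of "compl0 ?z" ?w w] z z' 2
      by (simp add: compl0_closed join_closed0 meet_closed0 in1)
    moreover have "?z \<preceq> u" "?z \<preceq> v"
      using z z' uv by (meson trans1 in1 meet1)+
    then have "?z \<preceq> u \<sqinter>\<^bsub>L1\<^esub> v"
      using z z' uv by (simp add: meet1 in1)
    moreover have "?z \<in> C0" using z z' by (simp add: meet_closed0)
    ultimately show ?thesis
      using 2 uv by (auto simp: le21 meet1(1))
  qed
  then show ?thesis
    using uv by (simp add: meet_is_def carrierG meet1 le11)
qed

lemma compl0_top: "compl0 \<top>\<^bsub>L1\<^esub> = \<bottom>\<^bsub>L1\<^esub>"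
  by (metis antisym1 bot0 bot1 compl0_antitone compl0_closed compl0_compl0 in1 top0 top1)

lemma compl0_bottom: "compl0 \<bottom>\<^bsub>L1\<^esub> = \<top>\<^bsub>L1\<^esub>"
  by (metis compl0_compl0 compl0_top top0)

text \<open>Downward closure of \<open>L0\<close> in \<open>L1\<close> enters here: the only element of \<open>L0\<close> above such a \<open>u\<close> is the top,
so upper bounds of \<open>u\<close> in the dual copy are trivial. The upper bounds of \<open>\<iota> y\<close> in \<open>L1\<close>
are those of \<open>(core y)\<^sup>\<bottom>\<close>, the least element of \<open>L0\<close> above \<open>\<iota> y\<close>.\<close>

lemma join_is12:
  assumes u: "u \<in> C1 - (C0 - {\<top>\<^bsub>L1\<^esub>})" and y: "y \<in> C1"
  shows "join_is u (\<iota> y) (u \<squnion>\<^bsub>L1\<^esub> compl0 (core y))"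
proof -
  let ?z = "compl0 (core y)" let ?s = "u \<squnion>\<^bsub>L1\<^esub> ?z"
  have z: "?z \<in> C0" "?z \<in> C1" "compl0 ?z = core y" and uC: "u \<in> C1"
    using u y by (simp_all add: core_closed compl0_closed compl0_compl0 in1)
  have s: "?s \<in> C1" "u \<preceq> ?s" "?z \<preceq> ?s" using z uC by (simp_all add: join1)
  have "?s \<preceq>\<^sub>G t" if t: "t \<in> carrier G" "u \<preceq>\<^sub>G t" "\<iota> y \<preceq>\<^sub>G t" for t
    using t(1)
  proof (cases rule: carrierG_cases)
    case 1
    with t y obtain z' where z': "z' \<in> C0" "compl0 z' \<preceq> y" "z' \<preceq> t" by (auto simp: le21)
    then have "compl0 z' \<preceq> core y" using y by (simp add: core_max compl0_closed)
    then have "?z \<preceq> z'"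
      using z' y compl0_antitone[of "compl0 z'" "core y"]
      by (simp add: compl0_closed compl0_compl0 core_closed)
    then have "?z \<preceq> t" using z z' 1 by (meson trans1 in1)
    then show ?thesis using 1 t uC z s by (simp add: le11 join1)
  next
    case (2 w)
    with t uC obtain z' where z': "z' \<in> C0" "u \<preceq> z'" "w \<preceq> compl0 z'" by (auto simp: le12)
    then have "z' = \<top>\<^bsub>L1\<^esub>"
      using u down[of u z'] antisym1[of z' u] top1[of z'] by (auto simp: in1)
    with z' 2 have "w = \<bottom>\<^bsub>L1\<^esub>"
      by (simp add: compl0_top antisym1 bot1 in1 bot0)
    then have "t = \<top>\<^bsub>L1\<^esub>" using 2 by (simp add: iota0 bot0 compl0_bottom)
    then show ?thesis using s by (simp add: le11 top1 in1 top0)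
  qed
  moreover have "\<iota> y \<preceq>\<^sub>G ?s"
    using z s y by (auto simp: le21 core_below intro!: bexI[of _ ?z])
  ultimately show ?thesis
    using s uC by (simp add: join_is_def carrierG le11)
qed

lemma join_is_commute: "join_is u v s \<Longrightarrow> join_is v u s"
  unfolding join_is_def by blast

lemma join_is_ex:
  assumes "u \<in> carrier G" "v \<in> carrier G"
  shows "\<exists>s. join_is u v s"
proof -
  have 22: "\<exists>s. join_is (\<iota> x) (\<iota> y) s" if "x \<in> C1" "y \<in> C1" for x y
    using join_is_compl[of "\<iota> x" "\<iota> y" "x \<sqinter>\<^bsub>L1\<^esub> y"] meet_is11[of x y] that
    by (auto simp: complG_iota carrierG)
  have 12: "\<exists>s. join_is u (\<iota> y) s" if "u \<in> C1" "y \<in> C1" for u y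
  proof (cases "u \<in> C0")
    case True
    then have "u = \<iota> (compl0 u)" "compl0 u \<in> C1"
      by (simp_all add: iota0 compl0_closed compl0_compl0 in1)
    with that 22[of "compl0 u" y] show ?thesis by simp
  next
    case False
    with that join_is12[of u y] show ?thesis by blast
  qed
  from assms consider "u \<in> C1" "v \<in> C1" | y where "u \<in> C1" "y \<in> C1" "v = \<iota> y"
    | x where "x \<in> C1" "u = \<iota> x" "v \<in> C1" | x y where "x \<in> C1" "y \<in> C1" "u = \<iota> x" "v = \<iota> y"
    by (auto simp: carrierG)
  then show ?thesis
  proof cases
    case 1 then show ?thesis by (blast intro: join_is11)
  next
    case 2 then show ?thesis by (simp add: 12)
  next
    case 3 with 12[of v x] show ?thesis by (metis join_is_commute)
  next
    case 4 then show ?thesis by (simp add: 22)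
  qed
qed

lemma join_G: "join_is u v s \<Longrightarrow> u \<in> carrier G \<Longrightarrow> v \<in> carrier G \<Longrightarrow> u \<squnion>\<^bsub>G\<^esub> v = s"
  by (rule partial_order.join_eqI[OF partial_order_G]) (simp_all add: join_is_def)

lemma meet_G: "meet_is u v i \<Longrightarrow> u \<in> carrier G \<Longrightarrow> v \<in> carrier G \<Longrightarrow> u \<sqinter>\<^bsub>G\<^esub> v = i"
  by (rule partial_order.meet_eqI[OF partial_order_G]) (simp_all add: meet_is_def)

lemma meet_is_ex:
  assumes "u \<in> carrier G" "v \<in> carrier G"
  shows "\<exists>i. meet_is u v i"
  using join_is_ex[of "complG u" "complG v"] meet_is_compl assms by (auto simp: complG_closed)

lemma top_is: "u \<in> carrier G \<Longrightarrow> u \<preceq>\<^sub>G \<top>\<^bsub>L1\<^esub>"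
proof (erule carrierG_cases)
  fix x assume "x \<in> C1" "u = \<iota> x"
  then show "u \<preceq>\<^sub>G \<top>\<^bsub>L1\<^esub>"
    by (auto simp: le21 in1 top0 top1 refl1 compl0_top bot1 intro!: bexI[of _ "\<top>\<^bsub>L1\<^esub>"])
qed (simp add: le11 in1 top0 top1)

lemma bottom_is: "u \<in> carrier G \<Longrightarrow> \<bottom>\<^bsub>L1\<^esub> \<preceq>\<^sub>G u"
proof (erule carrierG_cases)
  fix x assume "x \<in> C1" "u = \<iota> x"
  then show "\<bottom>\<^bsub>L1\<^esub> \<preceq>\<^sub>G u"
    by (auto simp: le12 in1 bot0 top1 refl1 compl0_bottom intro!: bexI[of _ "\<bottom>\<^bsub>L1\<^esub>"])
qed (simp add: le11 in1 bot0 bot1)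

lemma top_bottom_carrier: "\<top>\<^bsub>L1\<^esub> \<in> carrier G" "\<bottom>\<^bsub>L1\<^esub> \<in> carrier G"
  by (simp_all add: carrierG in1 top0 bot0)

lemma top_G: "\<top>\<^bsub>G\<^esub> = \<top>\<^bsub>L1\<^esub>" and bottom_G: "\<bottom>\<^bsub>G\<^esub> = \<bottom>\<^bsub>L1\<^esub>"
  by (simp_all add: partial_order.top_eqI[OF partial_order_G]
      partial_order.bottom_eqI[OF partial_order_G] top_is bottom_is top_bottom_carrier)

lemma bounded_lattice_G: "bounded_lattice G"
proof (rule partial_order.bounded_latticeI[OF partial_order_G _ _ top_bottom_carrier(2) bottom_is
      top_bottom_carrier(1) top_is])
  fix u v assume "u \<in> carrier G" "v \<in> carrier G"
  then show "\<exists>s\<in>carrier G. u \<preceq>\<^sub>G s \<and> v \<preceq>\<^sub>G s \<and> (\<forall>t\<in>carrier G. u \<preceq>\<^sub>G t \<and> v \<preceq>\<^sub>G t \<longrightarrow> s \<preceq>\<^sub>G t)"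
    "\<exists>i\<in>carrier G. i \<preceq>\<^sub>G u \<and> i \<preceq>\<^sub>G v \<and> (\<forall>t\<in>carrier G. t \<preceq>\<^sub>G u \<and> t \<preceq>\<^sub>G v \<longrightarrow> t \<preceq>\<^sub>G i)"
    using join_is_ex[of u v] meet_is_ex[of u v] unfolding join_is_def meet_is_def by blast+
qed

text \<open>For \<open>x\<close> outside \<open>L0\<close> the join of \<open>x\<close> and \<open>\<iota> x\<close> is \<open>x \<squnion> (core x)\<^sup>\<bottom>\<close>, which is above
\<open>core x \<squnion> (core x)\<^sup>\<bottom> = 1\<close>.\<close>

lemma join_compl:
  assumes "u \<in> carrier G"
  shows "join_is u (complG u) \<top>\<^bsub>L1\<^esub>"
proof -
  have C1: "join_is x (\<iota> x) \<top>\<^bsub>L1\<^esub>" if x: "x \<in> C1" for x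
  proof (cases "x \<in> C0")
    case True
    then show ?thesis
      using join_is11[of x "compl0 x"] by (simp add: in1 iota0 compl0_closed compl0_join)
  next
    case False
    let ?c = "core x"
    have "?c \<squnion>\<^bsub>L1\<^esub> compl0 ?c \<preceq> x \<squnion>\<^bsub>L1\<^esub> compl0 ?c"
      using x core_closed[OF x] core_below[OF x] trans1[of ?c x "x \<squnion>\<^bsub>L1\<^esub> compl0 ?c"]
      by (simp add: join1 in1 compl0_closed)
    then have "x \<squnion>\<^bsub>L1\<^esub> compl0 ?c = \<top>\<^bsub>L1\<^esub>"
      using x core_closed[OF x] by (simp add: compl0_join antisym1 top1 top0 in1 join1 compl0_closed)
    with join_is12[of x x] x False show ?thesis by simp
  qed
  from assms show ?thesis
  proof (cases rule: carrierG_cases)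
    case 1 then show ?thesis by (simp add: complG1 C1)
  next
    case (2 x) then show ?thesis by (simp add: complG_iota join_is_commute C1)
  qed
qed

lemma ortholattice_G: "ortholattice G"
proof (rule ortholattice.intro[OF bounded_lattice_G], unfold_locales)
  fix u assume u: "u \<in> carrier G"
  show "complG u \<in> carrier G" "complG (complG u) = u"
    using u by (simp_all add: complG_closed complG_complG)
  show "u \<squnion>\<^bsub>G\<^esub> complG u = \<top>\<^bsub>G\<^esub>"
    using join_compl[OF u] u by (simp add: join_G complG_closed top_G)
  have "join_is (complG u) (complG (complG u)) \<top>\<^bsub>L1\<^esub>"
    using join_compl[OF complG_closed[OF u]] .
  then have "meet_is u (complG u) (complG \<top>\<^bsub>L1\<^esub>)"
    using u by (intro meet_is_compl) (simp_all add: complG_closed)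
  moreover have "complG \<top>\<^bsub>L1\<^esub> = \<bottom>\<^bsub>L1\<^esub>"
    by (simp add: complG1 iota0 top0 in1 compl0_top)
  ultimately show "u \<sqinter>\<^bsub>G\<^esub> complG u = \<bottom>\<^bsub>G\<^esub>"
    using u by (simp add: meet_G complG_closed bottom_G)
next
  fix u v assume "u \<in> carrier G" "v \<in> carrier G" "u \<preceq>\<^sub>G v"
  then show "complG v \<preceq>\<^sub>G complG u" by (rule complG_antitone)
qed

lemma join_G1: "\<lbrakk>u \<in> C1; v \<in> C1\<rbrakk> \<Longrightarrow> u \<squnion>\<^bsub>G\<^esub> v = u \<squnion>\<^bsub>L1\<^esub> v"
  by (simp add: join_G join_is11 carrierG)

lemma meet_G1: "\<lbrakk>u \<in> C1; v \<in> C1\<rbrakk> \<Longrightarrow> u \<sqinter>\<^bsub>G\<^esub> v = u \<sqinter>\<^bsub>L1\<^esub> v"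
  by (simp add: meet_G meet_is11 carrierG)

lemma join_G12:
  "\<lbrakk>u \<in> C1 - (C0 - {\<top>\<^bsub>L1\<^esub>}); y \<in> C1\<rbrakk> \<Longrightarrow> u \<squnion>\<^bsub>G\<^esub> \<iota> y = u \<squnion>\<^bsub>L1\<^esub> compl0 (core y)"
  by (simp add: join_G join_is12 carrierG)

lemma subortholattice_G: "subortholattice L0 G"
proof -
  have "bounded_lattice L0"
    using ol by (simp add: ortholattice_def)
  then have "bounded_sublattice L0 G"
    by (simp add: bounded_sublattice_def bounded_lattice_G carrierG le01 le11 join01 join_G1
        meet01 meet_G1 bot01 bottom_G top01 top_G in1 subsetI)
  then show ?thesis
    using ol by (simp add: subortholattice_def ortholattice_G complG1 iota0 in1)
qed

text \<open>Passing to complements, \<open>w \<sqinter> \<iota> e\<close> is the complement of \<open>\<iota> w \<squnion> e = e \<squnion> (core w)\<^sup>\<bottom>\<close>. If joining with \<open>e\<close>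
does not change the core of \<open>(core w)\<^sup>\<bottom>\<close>, then a further mixed join, with \<open>e'\<close>, sees just \<open>core w\<close>.\<close>

lemma join_meet_recovers_core:
  assumes w: "w \<in> C1" and e: "e \<in> C1 - (C0 - {\<top>\<^bsub>L1\<^esub>})" and e': "e' \<in> C1 - (C0 - {\<top>\<^bsub>L1\<^esub>})"
    and core_e: "core (e \<squnion>\<^bsub>L1\<^esub> compl0 (core w)) = compl0 (core w)"
  shows "(w \<sqinter>\<^bsub>G\<^esub> \<iota> e) \<squnion>\<^bsub>G\<^esub> e' = core w \<squnion>\<^bsub>L1\<^esub> e'"
proof -
  let ?s = "e \<squnion>\<^bsub>L1\<^esub> compl0 (core w)"
  have c: "core w \<in> C0" "compl0 (core w) \<in> C0" using w by (simp_all add: core_closed compl0_closed)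
  then have s: "?s \<in> C1" using e by (simp add: join1 in1)
  have "join_is e (\<iota> w) ?s" using join_is12 w e by simp
  then have "join_is (complG w) (complG (\<iota> e)) ?s"
    using w e by (simp add: complG1 complG_iota join_is_commute)
  then have "w \<sqinter>\<^bsub>G\<^esub> \<iota> e = \<iota> ?s"
    using w e s meet_is_compl[of w "\<iota> e" ?s] by (simp add: meet_G carrierG complG1)
  moreover have "e' \<squnion>\<^bsub>G\<^esub> \<iota> ?s = e' \<squnion>\<^bsub>L1\<^esub> core w"
    using join_G12[OF e' s] core_e c by (simp add: compl0_compl0)
  ultimately show ?thesis by (simp add: join_comm)
qed

end

section \<open>The lattice of cells\<close>

text \<open>\<open>Point a\<close> records the argument \<open>a\<close>. The flags act as keys for joins: \<open>Lo\<close> and \<open>Hi\<close> make the joins with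
\<open>lo \<bottom>\<close> and \<open>hi \<bottom>\<close> grow with the argument, and \<open>Star\<close> together with a point forces the jump to a
value of \<open>f\<close>.\<close>

datatype 'a mark = Point 'a | Star | Lo | Hi

locale cell_extension =
  fixes L :: "('a, 'm) ortho_struct_scheme" (structure) and f :: "'a \<Rightarrow> 'a"
  assumes ol: "ortholattice L" and f: "f \<in> carrier L \<rightarrow> carrier L"
begin

abbreviation "C \<equiv> carrier L"
abbreviation between where "between b a \<equiv> \<lbrace>b..a\<rbrace>"

lemma le_refl: "x \<in> C \<Longrightarrow> x \<sqsubseteq> x"
  and le_trans: "\<lbrakk>x \<sqsubseteq> y; y \<sqsubseteq> z; x \<in> C; y \<in> C; z \<in> C\<rbrakk> \<Longrightarrow> x \<sqsubseteq> z"
  and le_antisym: "\<lbrakk>x \<sqsubseteq> y; y \<sqsubseteq> x; x \<in> C; y \<in> C\<rbrakk> \<Longrightarrow> x = y"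
  and join_facts: "\<lbrakk>x \<in> C; y \<in> C\<rbrakk> \<Longrightarrow> x \<squnion> y \<in> C"
    "\<lbrakk>x \<in> C; y \<in> C\<rbrakk> \<Longrightarrow> x \<sqsubseteq> x \<squnion> y" "\<lbrakk>x \<in> C; y \<in> C\<rbrakk> \<Longrightarrow> y \<sqsubseteq> x \<squnion> y"
    "\<lbrakk>x \<sqsubseteq> z; y \<sqsubseteq> z; x \<in> C; y \<in> C; z \<in> C\<rbrakk> \<Longrightarrow> x \<squnion> y \<sqsubseteq> z"
  and meet_facts: "\<lbrakk>x \<in> C; y \<in> C\<rbrakk> \<Longrightarrow> x \<sqinter> y \<in> C"
    "\<lbrakk>x \<in> C; y \<in> C\<rbrakk> \<Longrightarrow> x \<sqinter> y \<sqsubseteq> x" "\<lbrakk>x \<in> C; y \<in> C\<rbrakk> \<Longrightarrow> x \<sqinter> y \<sqsubseteq> y"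
    "\<lbrakk>z \<sqsubseteq> x; z \<sqsubseteq> y; x \<in> C; y \<in> C; z \<in> C\<rbrakk> \<Longrightarrow> z \<sqsubseteq> x \<sqinter> y"
  and le_top: "x \<in> C \<Longrightarrow> x \<sqsubseteq> \<top>" and bottom_le: "x \<in> C \<Longrightarrow> \<bottom> \<sqsubseteq> x"
  and top_in: "\<top> \<in> C" and bottom_in: "\<bottom> \<in> C"
  and compl_in: "x \<in> C \<Longrightarrow> x\<^sup>\<bottom> \<in> C"
  and compl_antitone: "\<lbrakk>x \<in> C; y \<in> C; x \<sqsubseteq> y\<rbrakk> \<Longrightarrow> y\<^sup>\<bottom> \<sqsubseteq> x\<^sup>\<bottom>"
  and compl_compl: "x \<in> C \<Longrightarrow> (x\<^sup>\<bottom>)\<^sup>\<bottom> = x"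
proof -
  interpret L: ortholattice L by (rule ol)
  show "x \<in> C \<Longrightarrow> x \<sqsubseteq> x"
    "\<lbrakk>x \<sqsubseteq> y; y \<sqsubseteq> z; x \<in> C; y \<in> C; z \<in> C\<rbrakk> \<Longrightarrow> x \<sqsubseteq> z"
    "\<lbrakk>x \<sqsubseteq> y; y \<sqsubseteq> x; x \<in> C; y \<in> C\<rbrakk> \<Longrightarrow> x = y"
    "\<lbrakk>x \<in> C; y \<in> C\<rbrakk> \<Longrightarrow> x \<squnion> y \<in> C"
    "\<lbrakk>x \<in> C; y \<in> C\<rbrakk> \<Longrightarrow> x \<sqsubseteq> x \<squnion> y" "\<lbrakk>x \<in> C; y \<in> C\<rbrakk> \<Longrightarrow> y \<sqsubseteq> x \<squnion> y"
    "\<lbrakk>x \<sqsubseteq> z; y \<sqsubseteq> z; x \<in> C; y \<in> C; z \<in> C\<rbrakk> \<Longrightarrow> x \<squnion> y \<sqsubseteq> z"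
    "\<lbrakk>x \<in> C; y \<in> C\<rbrakk> \<Longrightarrow> x \<sqinter> y \<in> C"
    "\<lbrakk>x \<in> C; y \<in> C\<rbrakk> \<Longrightarrow> x \<sqinter> y \<sqsubseteq> x" "\<lbrakk>x \<in> C; y \<in> C\<rbrakk> \<Longrightarrow> x \<sqinter> y \<sqsubseteq> y"
    "\<lbrakk>z \<sqsubseteq> x; z \<sqsubseteq> y; x \<in> C; y \<in> C; z \<in> C\<rbrakk> \<Longrightarrow> z \<sqsubseteq> x \<sqinter> y"
    "x \<in> C \<Longrightarrow> x \<sqsubseteq> \<top>" "x \<in> C \<Longrightarrow> \<bottom> \<sqsubseteq> x" "\<top> \<in> C" "\<bottom> \<in> C"
    "x \<in> C \<Longrightarrow> x\<^sup>\<bottom> \<in> C"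
    "\<lbrakk>x \<in> C; y \<in> C; x \<sqsubseteq> y\<rbrakk> \<Longrightarrow> y\<^sup>\<bottom> \<sqsubseteq> x\<^sup>\<bottom>"
    "x \<in> C \<Longrightarrow> (x\<^sup>\<bottom>)\<^sup>\<bottom> = x"
    by (fact L.le_refl L.le_trans L.le_antisym L.join_closed L.join_left L.join_right
        L.join_le L.meet_closed L.meet_left L.meet_right L.meet_le
        L.top_higher L.bottom_lower L.top_closed L.bottom_closed
        L.ocompl_closed L.ocompl_antitone L.ocompl_involutive)+
qed

lemma f_in: "a \<in> C \<Longrightarrow> f a \<in> C"
  using f by blast

lemma top_le_iff: "x \<in> C \<Longrightarrow> \<top> \<sqsubseteq> x \<longleftrightarrow> x = \<top>"
  using le_antisym le_top le_refl top_in by metis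

lemma le_bottom_iff: "x \<in> C \<Longrightarrow> x \<sqsubseteq> \<bottom> \<longleftrightarrow> x = \<bottom>"
  using le_antisym bottom_le le_refl bottom_in by metis

lemma compl_le_iff: "\<lbrakk>x \<in> C; y \<in> C\<rbrakk> \<Longrightarrow> x\<^sup>\<bottom> \<sqsubseteq> y \<longleftrightarrow> y\<^sup>\<bottom> \<sqsubseteq> x"
  using compl_antitone compl_compl compl_in by metis

lemma le_meet_iff: "\<lbrakk>x \<in> C; y \<in> C; z \<in> C\<rbrakk> \<Longrightarrow> z \<sqsubseteq> x \<sqinter> y \<longleftrightarrow> z \<sqsubseteq> x \<and> z \<sqsubseteq> y"
  by (meson le_trans meet_facts)

lemma join_le_iff: "\<lbrakk>x \<in> C; y \<in> C; z \<in> C\<rbrakk> \<Longrightarrow> x \<squnion> y \<sqsubseteq> z \<longleftrightarrow> x \<sqsubseteq> z \<and> y \<sqsubseteq> z"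
  by (meson le_trans join_facts)

lemma in_between: "z \<in> between b a \<longleftrightarrow> z \<in> C \<and> b \<sqsubseteq> z \<and> z \<sqsubseteq> a"
  by (simp add: at_least_at_most_def)

lemma between_inject:
  assumes "between b a = between b' a'" "b \<sqsubseteq> a" "b' \<sqsubseteq> a'" "b \<in> C" "a \<in> C" "b' \<in> C" "a' \<in> C"
  shows "b = b' \<and> a = a'"
proof -
  have "b \<in> between b a" "a \<in> between b a" "b' \<in> between b' a'" "a' \<in> between b' a'"
    using assms(2-) by (simp_all add: in_between le_refl)
  then have "b \<in> between b' a'" "a \<in> between b' a'" "b' \<in> between b a" "a' \<in> between b a"
    by (simp_all only: assms(1))
  then show ?thesis using assms(4-) by (simp add: in_between le_antisym)
qed

text \<open>A new element is a tag together with a list of parameters, the first of which is always the core.\<close>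

abbreviation star where "star x \<equiv> Inr (0 :: nat, [x]) :: 'a ext"
abbreviation interval where "interval x b a \<equiv> Inr (Suc 0, [x, b, a]) :: 'a ext"
abbreviation lo where "lo a \<equiv> Inr (2 :: nat, [a]) :: 'a ext"
abbreviation hi where "hi b \<equiv> Inr (3 :: nat, [b]) :: 'a ext"
abbreviation hit where "hit a \<equiv> Inr (4 :: nat, [f a, a]) :: 'a ext"

text \<open>No cell other than the old top has core \<open>\<top>\<close>: such a cell would lie above the top.\<close>

inductive_set cells :: "'a ext set" where
  old: "x \<in> C \<Longrightarrow> Inl x \<in> cells"
| star: "\<lbrakk>x \<in> C; x \<noteq> \<top>\<rbrakk> \<Longrightarrow> star x \<in> cells"
| interval: "\<lbrakk>x \<in> C; x \<noteq> \<top>; b \<in> C; a \<in> C; b \<sqsubseteq> a\<rbrakk> \<Longrightarrow> interval x b a \<in> cells"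
| lo: "\<lbrakk>a \<in> C; a \<noteq> \<top>\<rbrakk> \<Longrightarrow> lo a \<in> cells"
| hi: "\<lbrakk>b \<in> C; b \<noteq> \<top>\<rbrakk> \<Longrightarrow> hi b \<in> cells"
| hit: "\<lbrakk>a \<in> C; f a \<noteq> \<top>\<rbrakk> \<Longrightarrow> hit a \<in> cells"

definition proj :: "'a ext \<Rightarrow> 'a" where
  "proj u = (case u of Inl x \<Rightarrow> x | Inr (k, l) \<Rightarrow> hd l)"

text \<open>Giving the top all marks, and no point outside \<open>C\<close>, makes it the greatest cell in the componentwise
order and keeps all sets of points inside \<open>C\<close>.\<close>

definition marks :: "'a ext \<Rightarrow> 'a mark set" where
  "marks u = (case u of
       Inl x \<Rightarrow> if x = \<top> then {Star, Lo, Hi} \<union> Point ` C else {}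
     | Inr (k, l) \<Rightarrow>
         if k = 0 then {Star}
         else if k = Suc 0 then Point ` between (l ! 1) (l ! 2)
         else if k = 2 then insert Lo (Point ` between \<bottom> (l ! 0))
         else if k = 3 then insert Hi (Point ` between ((l ! 0)\<^sup>\<bottom>) \<top>)
         else {Star, Point (l ! 1)})"

lemma proj_simps [simp]:
  "proj (Inl x) = x" "proj (star x) = x" "proj (interval x b a) = x"
  "proj (lo a) = a" "proj (hi b) = b" "proj (hit a) = f a"
  by (simp_all add: proj_def)

lemma marks_simps:
  "marks (Inl x) = (if x = \<top> then {Star, Lo, Hi} \<union> Point ` C else {})"
  "marks (star x) = {Star}"
  "marks (interval x b a) = Point ` between b a"
  "marks (lo a) = insert Lo (Point ` between \<bottom> a)"
  "marks (hi b) = insert Hi (Point ` between (b\<^sup>\<bottom>) \<top>)"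
  "marks (hit a) = {Star, Point a}"
  by (simp_all add: marks_def)

definition below :: "'a ext \<Rightarrow> 'a ext \<Rightarrow> bool" (infix \<open>\<preceq>\<close> 50) where
  "u \<preceq> v \<longleftrightarrow> proj u \<sqsubseteq> proj v \<and> marks u \<subseteq> marks v"

definition L1 :: "'a ext gorder" where
  "L1 = \<lparr>carrier = cells, eq = (=), le = below\<rparr>"

definition points :: "'a mark set \<Rightarrow> 'a set" where
  "points S = {z. Point z \<in> S}"

lemma proj_in: "u \<in> cells \<Longrightarrow> proj u \<in> C"
  by (erule cells.cases) (simp_all add: f_in)

lemma proj_top_iff: "u \<in> cells \<Longrightarrow> proj u = \<top> \<longleftrightarrow> u = Inl \<top>"
  by (erule cells.cases) simp_all

lemma points_marks:
  "points (marks (Inl x)) = (if x = \<top> then between \<bottom> \<top> else {})"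
  "points (marks (star x)) = {}"
  "points (marks (interval x b a)) = between b a"
  "points (marks (lo a)) = between \<bottom> a"
  "points (marks (hi b)) = between (b\<^sup>\<bottom>) \<top>"
  "points (marks (hit a)) = {a}"
  by (auto simp: points_def marks_simps in_between le_top bottom_le)

lemma between_same: "a \<in> C \<Longrightarrow> between a a = {a}"
  by (auto simp: in_between le_refl le_antisym)

text \<open>The lattice structure of the cells rests on this: at the level of points only the empty set and
closed intervals occur, and these are closed under intersection.\<close>

lemma points_marks_cases:
  assumes "u \<in> cells"
  obtains "points (marks u) = {}"
  | b a where "b \<in> C" "a \<in> C" "b \<sqsubseteq> a" "points (marks u) = between b a"
  using assms
proof (cases rule: cells.cases)
  case (old x)
  then show ?thesis using that(1) that(2)[of \<bottom> \<top>]
    by (cases "x = \<top>") (simp_all add: points_marks bottom_in top_in bottom_le)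
next
  case (hit a)
  then show ?thesis using that(2)[of a a] by (simp add: points_marks between_same le_refl)
next
  case (lo a)
  then show ?thesis using that(2)[of \<bottom> a] by (simp add: points_marks bottom_in bottom_le)
next
  case (hi b)
  then show ?thesis using that(2)[of "b\<^sup>\<bottom>" \<top>] by (simp add: points_marks top_in le_top compl_in)
qed (use that in \<open>simp_all add: points_marks\<close>)

lemma marks_eqI:
  assumes "points S = points T" "Star \<in> S \<longleftrightarrow> Star \<in> T" "Lo \<in> S \<longleftrightarrow> Lo \<in> T" "Hi \<in> S \<longleftrightarrow> Hi \<in> T"
  shows "S = T"
proof (rule Set.set_eqI)
  fix m show "m \<in> S \<longleftrightarrow> m \<in> T"
    using assms by (cases m) (auto simp: points_def)
qed

lemma cell_with_Lo: "\<lbrakk>u \<in> cells; Lo \<in> marks u; u \<noteq> Inl \<top>\<rbrakk> \<Longrightarrow> u = lo (proj u)"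
  by (erule cells.cases) (auto simp: marks_simps split: if_splits)

lemma cell_with_Hi: "\<lbrakk>u \<in> cells; Hi \<in> marks u; u \<noteq> Inl \<top>\<rbrakk> \<Longrightarrow> u = hi (proj u)"
  by (erule cells.cases) (auto simp: marks_simps split: if_splits)

lemma cell_with_Star:
  "\<lbrakk>u \<in> cells; Star \<in> marks u; u \<noteq> Inl \<top>\<rbrakk> \<Longrightarrow> u = star (proj u) \<or> (\<exists>a\<in>C. u = hit a)"
  by (erule cells.cases) (auto simp: marks_simps split: if_splits)

lemma cell_without_flags:
  "\<lbrakk>u \<in> cells; Star \<notin> marks u; Lo \<notin> marks u; Hi \<notin> marks u\<rbrakk> \<Longrightarrow>
    u = Inl (proj u) \<and> proj u \<noteq> \<top> \<or> (\<exists>b\<in>C. \<exists>a\<in>C. b \<sqsubseteq> a \<and> u = interval (proj u) b a)"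
  by (erule cells.cases) (auto simp: marks_simps split: if_splits)

lemma cell_eqI:
  assumes u: "u \<in> cells" and v: "v \<in> cells" and p: "proj u = proj v" and m: "marks u = marks v"
  shows "u = v"
proof (cases "u = Inl \<top> \<or> v = Inl \<top>")
  case True
  then show ?thesis using u v p proj_top_iff by metis
next
  case False
  consider "Lo \<in> marks u" | "Hi \<in> marks u" | "Star \<in> marks u"
    | "Star \<notin> marks u" "Lo \<notin> marks u" "Hi \<notin> marks u" by blast
  then show ?thesis
  proof cases
    case 1 then show ?thesis using cell_with_Lo u v m p False by metis
  next
    case 2 then show ?thesis using cell_with_Hi u v m p False by metis
  next
    case 3
    then have "u = star (proj u) \<or> (\<exists>a\<in>C. u = hit a)" "v = star (proj v) \<or> (\<exists>a\<in>C. v = hit a)"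
      using cell_with_Star u v m False by metis+
    moreover have "points (marks u) = points (marks v)" by (simp add: m)
    ultimately show ?thesis using p
      by (metis insert_not_empty points_marks(2,6) singleton_inject)
  next
    case 4
    then have "u = Inl (proj u) \<and> proj u \<noteq> \<top> \<or> (\<exists>b\<in>C. \<exists>a\<in>C. b \<sqsubseteq> a \<and> u = interval (proj u) b a)"
      "v = Inl (proj v) \<and> proj v \<noteq> \<top> \<or> (\<exists>b\<in>C. \<exists>a\<in>C. b \<sqsubseteq> a \<and> v = interval (proj v) b a)"
      using cell_without_flags u v m by metis+
    moreover have pts: "points (marks u) = points (marks v)" by (simp add: m)
    moreover have ne: "between b a \<noteq> {}" if "b \<in> C" "b \<sqsubseteq> a" for b a
      using that in_between le_refl by blast
    ultimately consider "u = Inl (proj u)" "v = Inl (proj v)"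
      | b a b' a' where "u = interval (proj u) b a" "v = interval (proj v) b' a'"
         "b \<in> C" "a \<in> C" "b \<sqsubseteq> a" "b' \<in> C" "a' \<in> C" "b' \<sqsubseteq> a'" "between b a = between b' a'"
      by (metis points_marks(1,3))
    then show ?thesis
    proof cases
      case 1 then show ?thesis using p by metis
    next
      case 2 then show ?thesis using between_inject[of b a b' a'] p by metis
    qed
  qed
qed

lemma partial_order_L1: "partial_order L1"
proof (rule partial_orderI)
  fix u v w assume "u \<in> carrier L1" "v \<in> carrier L1" "w \<in> carrier L1" "u \<sqsubseteq>\<^bsub>L1\<^esub> v" "v \<sqsubseteq>\<^bsub>L1\<^esub> w"
  then show "u \<sqsubseteq>\<^bsub>L1\<^esub> w"
    by (simp add: L1_def below_def) (meson le_trans order_trans proj_in)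
next
  fix u v assume "u \<in> carrier L1" "v \<in> carrier L1" "u \<sqsubseteq>\<^bsub>L1\<^esub> v" "v \<sqsubseteq>\<^bsub>L1\<^esub> u"
  then show "u = v"
    by (intro cell_eqI le_antisym equalityI) (simp_all add: L1_def below_def proj_in)
qed (simp_all add: L1_def below_def le_refl proj_in)

text \<open>The supremum and infimum are required only of nonempty sets, since a cell without points is not
constrained by them. In this way a lattice that is not complete is covered together with a
complete one.\<close>

definition has_sup_inf :: "'a set \<Rightarrow> bool" where
  "has_sup_inf K \<longleftrightarrow> K = {} \<or> (\<exists>i\<in>C. \<exists>s\<in>C. (\<forall>k\<in>K. i \<sqsubseteq> k \<and> k \<sqsubseteq> s) \<and>
     (\<forall>t\<in>C. (\<forall>k\<in>K. k \<sqsubseteq> t) \<longrightarrow> s \<sqsubseteq> t) \<and> (\<forall>t\<in>C. (\<forall>k\<in>K. t \<sqsubseteq> k) \<longrightarrow> t \<sqsubseteq> i))"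

lemma has_sup_inf_between: "\<lbrakk>b \<in> C; a \<in> C; b \<sqsubseteq> a\<rbrakk> \<Longrightarrow> has_sup_inf (between b a)"
  unfolding has_sup_inf_def
  by (rule disjI2, rule bexI[of _ b], rule bexI[of _ a]) (auto simp: in_between le_refl)

lemma has_sup_inf_points: "u \<in> cells \<Longrightarrow> has_sup_inf (points (marks u))"
  by (erule points_marks_cases) (simp_all add: has_sup_inf_between, simp add: has_sup_inf_def)

lemma has_sup_inf_Un:
  assumes K: "has_sup_inf K" "K \<subseteq> C" and K': "has_sup_inf K'" "K' \<subseteq> C"
  shows "has_sup_inf (K \<union> K')"
proof (cases "K = {} \<or> K' = {}")
  case True
  then show ?thesis using assms by auto
next
  case False
  from K False obtain i s where si: "i \<in> C" "s \<in> C" "\<forall>k\<in>K. i \<sqsubseteq> k \<and> k \<sqsubseteq> s"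
     "\<forall>t\<in>C. (\<forall>k\<in>K. k \<sqsubseteq> t) \<longrightarrow> s \<sqsubseteq> t" "\<forall>t\<in>C. (\<forall>k\<in>K. t \<sqsubseteq> k) \<longrightarrow> t \<sqsubseteq> i"
    unfolding has_sup_inf_def by blast
  from K' False obtain i' s' where si': "i' \<in> C" "s' \<in> C" "\<forall>k\<in>K'. i' \<sqsubseteq> k \<and> k \<sqsubseteq> s'"
     "\<forall>t\<in>C. (\<forall>k\<in>K'. k \<sqsubseteq> t) \<longrightarrow> s' \<sqsubseteq> t" "\<forall>t\<in>C. (\<forall>k\<in>K'. t \<sqsubseteq> k) \<longrightarrow> t \<sqsubseteq> i'"
    unfolding has_sup_inf_def by blast
  have "i \<sqinter> i' \<sqsubseteq> k \<and> k \<sqsubseteq> s \<squnion> s'" if "k \<in> K \<union> K'" for k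
  proof -
    from that K K' have "k \<in> C" by blast
    from that have "i \<sqsubseteq> k \<and> k \<sqsubseteq> s \<or> i' \<sqsubseteq> k \<and> k \<sqsubseteq> s'" using si si' by blast
    moreover have "i \<sqinter> i' \<in> C" "i \<sqinter> i' \<sqsubseteq> i" "i \<sqinter> i' \<sqsubseteq> i'" "s \<squnion> s' \<in> C" "s \<sqsubseteq> s \<squnion> s'" "s' \<sqsubseteq> s \<squnion> s'"
      using si si' by (simp_all add: meet_facts join_facts)
    ultimately show ?thesis using \<open>k \<in> C\<close> si(1,2) si'(1,2) by (meson le_trans)
  qed
  moreover have "s \<squnion> s' \<sqsubseteq> t" if "t \<in> C" "\<forall>k\<in>K \<union> K'. k \<sqsubseteq> t" for t
    using that si si' by (simp add: join_facts)
  moreover have "t \<sqsubseteq> i \<sqinter> i'" if "t \<in> C" "\<forall>k\<in>K \<union> K'. t \<sqsubseteq> k" for t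
    using that si si' by (simp add: meet_facts)
  ultimately show ?thesis
    using si si' unfolding has_sup_inf_def
    by (intro disjI2 bexI[of _ "i \<sqinter> i'"] bexI[of _ "s \<squnion> s'"]) (simp_all add: join_facts meet_facts)
qed

lemma top_cell: "Inl \<top> \<in> cells" and below_top: "u \<in> cells \<Longrightarrow> u \<preceq> Inl \<top>"
proof -
  show "Inl \<top> \<in> cells" by (simp add: cells.old top_in)
  show "u \<preceq> Inl \<top>" if u: "u \<in> cells"
  proof -
    have "m \<in> marks (Inl \<top>)" if "m \<in> marks u" for m
    proof (cases m)
      case (Point z)
      with that u have "z \<in> C" by (cases rule: points_marks_cases[OF u]) (auto simp: points_def in_between)
      with Point show ?thesis by (simp add: marks_simps)
    qed (simp_all add: marks_simps)
    with u show ?thesis by (auto simp: below_def le_top proj_in)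
  qed
qed

text \<open>\<open>or_top x u\<close> stands for a cell \<open>u\<close> with core \<open>x\<close>, understood as the top if \<open>x = \<top>\<close>.\<close>

definition or_top :: "'a \<Rightarrow> 'a ext \<Rightarrow> 'a ext" where
  "or_top x u = (if x = \<top> then Inl \<top> else u)"

text \<open>Below the top a flag determines the kind of a cell. So \<open>lo x\<close>, \<open>hi x\<close>, \<open>star x\<close> and \<open>hit a\<close> are the
least cells that carry their flags and have a large enough core (for \<open>hit a\<close>: that carry the point
\<open>a\<close>). The next four lemmas are what the computations of joins use.\<close>

lemma lo_below:
  assumes "x \<in> C" "w \<in> cells" "Lo \<in> marks w" "x \<sqsubseteq> proj w"
  shows "or_top x (lo x) \<preceq> w"
proof (cases "w = Inl \<top>")
  case True
  then show ?thesis using assms(1) by (simp add: or_top_def below_top cells.lo top_cell)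
next
  case False
  have "w = lo (proj w)" using assms False cell_with_Lo by blast
  moreover have "x \<noteq> \<top>" using False assms proj_top_iff proj_in top_le_iff by metis
  moreover have "between \<bottom> x \<subseteq> between \<bottom> (proj w)"
    using assms proj_in[of w] by (clarsimp simp: in_between) (meson le_trans)
  ultimately have "marks (lo x) \<subseteq> marks w" by (metis image_mono insert_mono marks_simps(4))
  with \<open>x \<noteq> \<top>\<close> assms show ?thesis by (simp add: or_top_def below_def)
qed

lemma hi_below:
  assumes "x \<in> C" "w \<in> cells" "Hi \<in> marks w" "x \<sqsubseteq> proj w"
  shows "or_top x (hi x) \<preceq> w"
proof (cases "w = Inl \<top>")
  case True
  then show ?thesis using assms(1) by (simp add: or_top_def below_top cells.hi top_cell)
next
  case False
  have "w = hi (proj w)" using assms False cell_with_Hi by blast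
  moreover have "x \<noteq> \<top>" using False assms proj_top_iff proj_in top_le_iff by metis
  moreover have "(proj w)\<^sup>\<bottom> \<sqsubseteq> x\<^sup>\<bottom>" using assms proj_in compl_antitone by blast
  then have "between (x\<^sup>\<bottom>) \<top> \<subseteq> between ((proj w)\<^sup>\<bottom>) \<top>"
    using assms proj_in[of w] by (clarsimp simp: in_between) (meson le_trans compl_in)
  ultimately have "marks (hi x) \<subseteq> marks w" by (metis image_mono insert_mono marks_simps(5))
  with \<open>x \<noteq> \<top>\<close> assms show ?thesis by (simp add: or_top_def below_def)
qed

lemma star_below:
  assumes "x \<in> C" "w \<in> cells" "Star \<in> marks w" "x \<sqsubseteq> proj w"
  shows "or_top x (star x) \<preceq> w"
proof (cases "x = \<top>")
  case True
  then show ?thesis using assms by (metis below_top or_top_def proj_in proj_top_iff top_cell top_le_iff)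
next
  case False
  then show ?thesis using assms by (simp add: or_top_def below_def marks_simps)
qed

lemma hit_below:
  assumes "a \<in> C" "w \<in> cells" "Star \<in> marks w" "Point a \<in> marks w"
  shows "or_top (f a) (hit a) \<preceq> w"
proof (cases "w = Inl \<top>")
  case True
  then show ?thesis using assms(1) by (simp add: or_top_def below_top cells.hit top_cell)
next
  case False
  then have "w = star (proj w) \<or> (\<exists>a\<in>C. w = hit a)" using cell_with_Star assms by blast
  moreover have "a \<in> points (marks w)" using assms by (simp add: points_def)
  ultimately have w: "w = hit a" by (metis empty_iff points_marks(2,6) singletonD)
  then have "f a \<noteq> \<top>" using False assms proj_top_iff[of w] by auto
  with w assms show ?thesis by (simp add: or_top_def below_def le_refl f_in)
qed

lemma or_top_cell: "(x \<noteq> \<top> \<Longrightarrow> u \<in> cells) \<Longrightarrow> or_top x u \<in> cells"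
  by (simp add: or_top_def top_cell)

lemma below_or_top: "v \<in> cells \<Longrightarrow> (x \<noteq> \<top> \<Longrightarrow> v \<preceq> u) \<Longrightarrow> v \<preceq> or_top x u"
  by (simp add: or_top_def below_top)

lemma flagless: "\<lbrakk>Star \<notin> S; Lo \<notin> S; Hi \<notin> S\<rbrakk> \<Longrightarrow> S = Point ` points S"
  by (rule marks_eqI) (auto simp: points_def)

text \<open>The source of all joins. If any cell below the top satisfies the two lower bounds, then the flags in \<open>S\<close>
determine its kind, and the parameters can be minimised: for \<open>Lo\<close> to the join of \<open>x\<close> with the
points, for \<open>Hi\<close> to the join of \<open>x\<close> with their complements, for points alone to the interval that they
span, while \<open>Star\<close> together with a point \<open>a\<close> leaves only \<open>hit a\<close>.\<close>

lemma least_cell_ex: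
  assumes x: "x \<in> C" and K: "points S \<subseteq> C" "has_sup_inf (points S)"
  shows "\<exists>u\<in>cells. x \<sqsubseteq> proj u \<and> S \<subseteq> marks u \<and>
           (\<forall>v\<in>cells. x \<sqsubseteq> proj v \<and> S \<subseteq> marks v \<longrightarrow> u \<preceq> v)"
proof (cases "\<exists>v\<in>cells. v \<noteq> Inl \<top> \<and> x \<sqsubseteq> proj v \<and> S \<subseteq> marks v")
  case False
  have "S \<subseteq> marks (Inl \<top>)"
  proof
    fix m assume "m \<in> S"
    then show "m \<in> marks (Inl \<top>)" using K(1) by (cases m) (auto simp: marks_simps points_def)
  qed
  moreover have "Inl \<top> \<preceq> Inl \<top>" by (rule below_top[OF top_cell])
  ultimately show ?thesis using False top_cell x le_top by (intro bexI[of _ "Inl \<top>"]) auto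
next
  case True
  then obtain v where v: "v \<in> cells" "v \<noteq> Inl \<top>" "x \<sqsubseteq> proj v" "S \<subseteq> marks v" by blast
  have pv: "proj v \<in> C" "proj v \<noteq> \<top>" using v proj_in proj_top_iff by simp_all
  then have xt: "x \<noteq> \<top>" using v top_le_iff by auto
  have KD: "points S \<subseteq> points (marks w)" if "S \<subseteq> marks w" for w
    using that by (auto simp: points_def)
  consider "Lo \<in> S" | "Hi \<in> S" | "Star \<in> S" "points S = {}" "Lo \<notin> S" "Hi \<notin> S"
    | "Star \<in> S" "points S \<noteq> {}" "Lo \<notin> S" "Hi \<notin> S"
    | "Star \<notin> S" "Lo \<notin> S" "Hi \<notin> S" "points S = {}"
    | "Star \<notin> S" "Lo \<notin> S" "Hi \<notin> S" "points S \<noteq> {}"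
    by blast
  then show ?thesis
  proof cases
    case Lo: 1
    \<comment> \<open>The parameter of the least \<open>lo\<close>-cell: the supremum of \<open>x\<close> and the points.\<close>
    have "\<exists>t\<in>C. x \<sqsubseteq> t \<and> (\<forall>k\<in>points S. k \<sqsubseteq> t) \<and>
        (\<forall>a\<in>C. x \<sqsubseteq> a \<and> (\<forall>k\<in>points S. k \<sqsubseteq> a) \<longrightarrow> t \<sqsubseteq> a)"
    proof (cases "points S = {}")
      case True with x le_refl show ?thesis by auto
    next
      case False
      with K obtain s where s: "s \<in> C" "\<forall>k\<in>points S. k \<sqsubseteq> s"
        "\<forall>t\<in>C. (\<forall>k\<in>points S. k \<sqsubseteq> t) \<longrightarrow> s \<sqsubseteq> t" unfolding has_sup_inf_def by blast
      have "k \<sqsubseteq> x \<squnion> s" if "k \<in> points S" for k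
        using that s x K by (meson le_trans join_facts subsetD)
      with s x show ?thesis by (intro bexI[of _ "x \<squnion> s"]) (simp_all add: join_facts)
    qed
    then obtain t where t: "t \<in> C" "x \<sqsubseteq> t" "\<forall>k\<in>points S. k \<sqsubseteq> t"
      "\<And>a. \<lbrakk>a \<in> C; x \<sqsubseteq> a; \<forall>k\<in>points S. k \<sqsubseteq> a\<rbrakk> \<Longrightarrow> t \<sqsubseteq> a" by blast
    have lo: "w = lo (proj w) \<and> t \<sqsubseteq> proj w"
      if w: "w \<in> cells" "w \<noteq> Inl \<top>" "x \<sqsubseteq> proj w" "S \<subseteq> marks w" for w
    proof -
      have e: "w = lo (proj w)" using cell_with_Lo w Lo by blast
      have "points (marks w) = between \<bottom> (proj w)" by (subst e) (simp add: points_marks)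
      then have "\<forall>k\<in>points S. k \<sqsubseteq> proj w" using KD[OF w(4)] in_between by blast
      with e t(4) w proj_in show ?thesis by blast
    qed
    from lo[of v] v pv t have tt: "t \<noteq> \<top>" using top_le_iff by auto
    have "Star \<notin> S" "Hi \<notin> S"
    proof -
      have "v = lo (proj v)" using lo v by blast
      then have "marks v = insert Lo (Point ` between \<bottom> (proj v))" by (metis marks_simps(4))
      with v show "Star \<notin> S" "Hi \<notin> S" by auto
    qed
    have "S \<subseteq> marks (lo t)"
    proof
      fix m assume "m \<in> S"
      then show "m \<in> marks (lo t)"
        using \<open>Star \<notin> S\<close> \<open>Hi \<notin> S\<close> t K
        by (cases m) (auto simp: marks_simps points_def in_between bottom_le)
    qed
    moreover have "lo t \<preceq> w" if w: "w \<in> cells" "x \<sqsubseteq> proj w" "S \<subseteq> marks w" for w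
    proof -
      have "t \<sqsubseteq> proj w" using lo[of w] w t(1) le_top by (cases "w = Inl \<top>") simp_all
      then show ?thesis using lo_below[of t w] t(1) tt w Lo by (auto simp: or_top_def)
    qed
    ultimately show ?thesis using t tt by (intro bexI[of _ "lo t"]) (auto intro: cells.lo)
  next
    case Hi: 2
    \<comment> \<open>The parameter of the least \<open>hi\<close>-cell: the points have to lie above its complement, so
      it is the join of \<open>x\<close> with the complement of the infimum of the points.\<close>
    have "\<exists>t\<in>C. x \<sqsubseteq> t \<and> (\<forall>k\<in>points S. t\<^sup>\<bottom> \<sqsubseteq> k) \<and>
        (\<forall>a\<in>C. x \<sqsubseteq> a \<and> (\<forall>k\<in>points S. a\<^sup>\<bottom> \<sqsubseteq> k) \<longrightarrow> t \<sqsubseteq> a)"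
    proof (cases "points S = {}")
      case True with x le_refl show ?thesis by auto
    next
      case False
      with K obtain s where s: "s \<in> C" "\<forall>k\<in>points S. s \<sqsubseteq> k"
        "\<forall>t\<in>C. (\<forall>k\<in>points S. t \<sqsubseteq> k) \<longrightarrow> t \<sqsubseteq> s" unfolding has_sup_inf_def by blast
      let ?t = "x \<squnion> s\<^sup>\<bottom>"
      have t: "?t \<in> C" using s x by (simp add: join_facts compl_in)
      have "?t\<^sup>\<bottom> \<sqsubseteq> s" using s x t by (simp add: compl_le_iff[OF t s(1)] join_facts compl_in)
      then have "?t\<^sup>\<bottom> \<sqsubseteq> k" if "k \<in> points S" for k
        using that s t K by (meson le_trans compl_in subsetD)
      moreover have "?t \<sqsubseteq> a" if "a \<in> C" "x \<sqsubseteq> a" "\<forall>k\<in>points S. a\<^sup>\<bottom> \<sqsubseteq> k" for a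
        using that s x compl_le_iff[of a s] by (simp add: join_facts compl_in)
      ultimately show ?thesis using t s x by (intro bexI[of _ ?t]) (simp_all add: join_facts compl_in)
    qed
    then obtain t where t: "t \<in> C" "x \<sqsubseteq> t" "\<forall>k\<in>points S. t\<^sup>\<bottom> \<sqsubseteq> k"
      "\<And>a. \<lbrakk>a \<in> C; x \<sqsubseteq> a; \<forall>k\<in>points S. a\<^sup>\<bottom> \<sqsubseteq> k\<rbrakk> \<Longrightarrow> t \<sqsubseteq> a" by blast
    have hi: "w = hi (proj w) \<and> t \<sqsubseteq> proj w"
      if w: "w \<in> cells" "w \<noteq> Inl \<top>" "x \<sqsubseteq> proj w" "S \<subseteq> marks w" for w
    proof -
      have e: "w = hi (proj w)" using cell_with_Hi w Hi by blast
      have "points (marks w) = between ((proj w)\<^sup>\<bottom>) \<top>" by (subst e) (simp add: points_marks)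
      then have "\<forall>k\<in>points S. (proj w)\<^sup>\<bottom> \<sqsubseteq> k" using KD[OF w(4)] in_between by blast
      with e t(4) w proj_in show ?thesis by blast
    qed
    from hi[of v] v pv t have tt: "t \<noteq> \<top>" using top_le_iff by auto
    have "Star \<notin> S" "Lo \<notin> S"
    proof -
      have "v = hi (proj v)" using hi v by blast
      then have "marks v = insert Hi (Point ` between ((proj v)\<^sup>\<bottom>) \<top>)" by (metis marks_simps(5))
      with v show "Star \<notin> S" "Lo \<notin> S" by auto
    qed
    have "S \<subseteq> marks (hi t)"
    proof
      fix m assume "m \<in> S"
      then show "m \<in> marks (hi t)"
        using \<open>Star \<notin> S\<close> \<open>Lo \<notin> S\<close> t K
        by (cases m) (auto simp: marks_simps points_def in_between le_top)
    qed
    moreover have "hi t \<preceq> w" if w: "w \<in> cells" "x \<sqsubseteq> proj w" "S \<subseteq> marks w" for w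
    proof -
      have "t \<sqsubseteq> proj w" using hi[of w] w t(1) le_top by (cases "w = Inl \<top>") simp_all
      then show ?thesis using hi_below[of t w] t(1) tt w Hi by (auto simp: or_top_def)
    qed
    ultimately show ?thesis using t tt by (intro bexI[of _ "hi t"]) (auto intro: cells.hi)
  next
    case 3
    then have "S = {Star}" by (intro marks_eqI) (auto simp: points_def)
    then show ?thesis using x xt
      by (intro bexI[of _ "star x"]) (auto simp: marks_simps below_def le_refl intro: cells.star)
  next
    case 4
    then have Sv: "Star \<in> marks v" "points (marks v) \<noteq> {}" using v KD[OF v(4)] by auto
    then obtain a where a: "a \<in> C" "v = hit a"
      using cell_with_Star[OF v(1) _ v(2)] points_marks(2) by metis
    have pS: "points S = {a}" using KD[OF v(4)] 4 a by (auto simp: points_marks)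
    have S: "S = {Star, Point a}"
      by (rule marks_eqI) (use 4 pS in \<open>auto simp: points_def\<close>)
    have "v \<preceq> w" if w: "w \<in> cells" "x \<sqsubseteq> proj w" "S \<subseteq> marks w" for w
      using hit_below[of a w] a pv S w by (auto simp: or_top_def)
    with v show ?thesis by blast
  next
    case 5
    then have "S = {}" by (intro marks_eqI) (auto simp: points_def)
    then show ?thesis using x xt
      by (intro bexI[of _ "Inl x"]) (auto simp: marks_simps below_def le_refl intro: cells.old)
  next
    case 6
    then have S: "S = Point ` points S" by (intro flagless)
    from 6 K obtain i s where si: "i \<in> C" "s \<in> C" "\<forall>k\<in>points S. i \<sqsubseteq> k \<and> k \<sqsubseteq> s"
     "\<forall>t\<in>C. (\<forall>k\<in>points S. k \<sqsubseteq> t) \<longrightarrow> s \<sqsubseteq> t" "\<forall>t\<in>C. (\<forall>k\<in>points S. t \<sqsubseteq> k) \<longrightarrow> t \<sqsubseteq> i"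
      unfolding has_sup_inf_def by blast
    with 6 K have "i \<sqsubseteq> s" by (meson ex_in_conv le_trans subsetD)
    then have cell: "interval x i s \<in> cells" using si x xt by (intro cells.interval)
    have sub: "points S \<subseteq> between i s" using si K by (auto simp: in_between)
    then have "S \<subseteq> marks (interval x i s)" by (subst S) (auto simp: marks_simps)
    moreover have "interval x i s \<preceq> w" if w: "w \<in> cells" "x \<sqsubseteq> proj w" "S \<subseteq> marks w" for w
    proof -
      have "between i s \<subseteq> points (marks w)"
        using w(1)
      proof (cases rule: points_marks_cases)
        case 1 with KD[OF w(3)] 6 show ?thesis by auto
      next
        case (2 b a)
        then have "b \<sqsubseteq> i" "s \<sqsubseteq> a" using KD[OF w(3)] si in_between by blast+
        with 2 si show ?thesis by (clarsimp simp: in_between) (meson le_trans)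
      qed
      then show ?thesis using w(2) by (auto simp: below_def marks_simps points_def)
    qed
    ultimately show ?thesis using cell x by (intro bexI[of _ "interval x i s"]) (simp_all add: le_refl)
  qed
qed

lemma carrier_L1 [simp]: "carrier L1 = cells" and le_L1 [simp]: "u \<sqsubseteq>\<^bsub>L1\<^esub> v \<longleftrightarrow> u \<preceq> v"
  by (simp_all add: L1_def)

lemma points_Int: "points (S \<inter> T) = points S \<inter> points T"
  and points_Un: "points (S \<union> T) = points S \<union> points T"
  by (auto simp: points_def)

lemma points_in: "u \<in> cells \<Longrightarrow> points (marks u) \<subseteq> C"
  by (erule points_marks_cases) (auto simp: in_between)

text \<open>Holds for \<open>x = \<top>\<close> too, because the top is the only cell with core \<open>\<top>\<close>. In particular \<open>proj u\<close> is the
greatest element of \<open>L\<close> below \<open>u\<close>.\<close>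

lemma old_below: "\<lbrakk>x \<in> C; w \<in> cells\<rbrakk> \<Longrightarrow> Inl x \<preceq> w \<longleftrightarrow> x \<sqsubseteq> proj w"
  using proj_top_iff[of w] top_le_iff[of "proj w"] proj_in[of w]
  by (auto simp: below_def marks_simps)

lemma bottom_below: "u \<in> cells \<Longrightarrow> Inl \<bottom> \<preceq> u"
  by (simp add: old_below bottom_in bottom_le proj_in)

text \<open>Apart from the top, different kinds of cells have no flag other than \<open>Star\<close> in common, and
\<open>star\<close>-cells have no points. So the marks shared by two different kinds are none, only \<open>Star\<close>, or an
interval of points, and each of these sets occurs with every core other than \<open>\<top>\<close>. The same is true of
\<open>hit a\<close> and \<open>hit b\<close> for \<open>a \<noteq> b\<close>; two \<open>lo\<close>-cells or two \<open>hi\<close>-cells meet in a cell of their kind.\<close>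

lemma meet_cell_ex:
  assumes u: "u \<in> cells" and v: "v \<in> cells"
  shows "\<exists>w\<in>cells. proj w = proj u \<sqinter> proj v \<and> marks w = marks u \<inter> marks v"
proof -
  have top: "\<top> \<sqinter> x = x" "x \<sqinter> \<top> = x" "x \<sqinter> x = x" if "x \<in> C" for x
    using that by (simp_all add: le_antisym meet_facts top_in le_top le_refl)
  have marks_top: "marks w \<subseteq> marks (Inl \<top>)" if "w \<in> cells" for w
    using below_top[OF that] by (simp add: below_def)
  let ?x = "proj u \<sqinter> proj v" and ?S = "marks u \<inter> marks v"
  have x: "?x \<in> C" using u v by (simp add: proj_in meet_facts)
  consider "u = Inl \<top>" | "v = Inl \<top>" | "u \<noteq> Inl \<top>" "v \<noteq> Inl \<top>" by blast
  then show ?thesis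
  proof cases
    case 1
    have "marks u \<inter> marks v = marks v" using marks_top[OF v] 1 by blast
    with 1 v top show ?thesis by (intro bexI[of _ v]) (simp_all add: proj_in)
  next
    case 2
    have "marks u \<inter> marks v = marks u" using marks_top[OF u] 2 by blast
    with 2 u top show ?thesis by (intro bexI[of _ u]) (simp_all add: proj_in)
  next
    case nontop: 3
    then have "proj u \<noteq> \<top>" using u proj_top_iff by simp
    moreover have "?x \<sqsubseteq> proj u" using u v by (simp add: meet_facts proj_in)
    ultimately have xt: "?x \<noteq> \<top>" using u by (metis proj_in top_le_iff)
    consider "Lo \<in> ?S" | "Hi \<in> ?S" | "Star \<in> ?S" "Lo \<notin> ?S" "Hi \<notin> ?S" "points ?S = {}"
      | "Star \<in> ?S" "Lo \<notin> ?S" "Hi \<notin> ?S" "points ?S \<noteq> {}"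
      | "Star \<notin> ?S" "Lo \<notin> ?S" "Hi \<notin> ?S" "points ?S = {}"
      | "Star \<notin> ?S" "Lo \<notin> ?S" "Hi \<notin> ?S" "points ?S \<noteq> {}" by blast
    then show ?thesis
    proof cases
      case 1
      then have "u = lo (proj u)" "v = lo (proj v)" using u v nontop cell_with_Lo by blast+
      then obtain a a' where e: "u = lo a" "v = lo a'" by blast
      with u v have aa: "a \<in> C" "a' \<in> C" using proj_in by fastforce+
      have "between \<bottom> (a \<sqinter> a') = between \<bottom> a \<inter> between \<bottom> a'"
        using aa by (auto simp: in_between le_meet_iff)
      then have "marks (lo (a \<sqinter> a')) = ?S"
        unfolding e by (intro marks_eqI) (auto simp: points_Int points_marks, auto simp: marks_simps)
      then show ?thesis using e x xt by (intro bexI[of _ "lo (a \<sqinter> a')"]) (simp_all add: cells.lo)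
    next
      case 2
      then have "u = hi (proj u)" "v = hi (proj v)" using u v nontop cell_with_Hi by blast+
      then obtain a a' where e: "u = hi a" "v = hi a'" by blast
      with u v have aa: "a \<in> C" "a' \<in> C" using proj_in by fastforce+
      have "(a \<sqinter> a')\<^sup>\<bottom> \<sqsubseteq> z \<longleftrightarrow> a\<^sup>\<bottom> \<sqsubseteq> z \<and> a'\<^sup>\<bottom> \<sqsubseteq> z" if "z \<in> C" for z
        using aa that by (simp add: compl_le_iff[of _ z] le_meet_iff meet_facts compl_in)
      then have "between ((a \<sqinter> a')\<^sup>\<bottom>) \<top> = between (a\<^sup>\<bottom>) \<top> \<inter> between (a'\<^sup>\<bottom>) \<top>"
        by (auto simp: in_between)
      then have "marks (hi (a \<sqinter> a')) = ?S"
        unfolding e by (intro marks_eqI) (auto simp: points_Int points_marks, auto simp: marks_simps)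
      then show ?thesis using e x xt by (intro bexI[of _ "hi (a \<sqinter> a')"]) (simp_all add: cells.hi)
    next
      case 3
      then have "?S = {Star}" by (intro marks_eqI) (auto simp: points_def)
      then show ?thesis using x xt
        by (intro bexI[of _ "star ?x"]) (simp_all add: marks_simps cells.star)
    next
      case 4
      then have "points (marks u) \<noteq> {}" "points (marks v) \<noteq> {}" by (auto simp: points_Int)
      with 4 u v nontop obtain a a' where e: "u = hit a" "v = hit a'"
        using cell_with_Star points_marks(2) by (metis IntD1 IntD2)
      with 4 have "v = u" by (auto simp: points_Int points_marks)
      with u top show ?thesis by (intro bexI[of _ u]) (simp_all add: proj_in)
    next
      case 5
      then have "?S = {}" by (intro marks_eqI) (auto simp: points_def)
      then show ?thesis using x xt
        by (intro bexI[of _ "Inl ?x"]) (simp_all add: marks_simps cells.old)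
    next
      case 6
      then have "points (marks u) \<noteq> {}" "points (marks v) \<noteq> {}" by (auto simp: points_Int)
      then obtain b a b' a' where i: "b \<in> C" "a \<in> C" "b' \<in> C" "a' \<in> C"
        "points (marks u) = between b a" "points (marks v) = between b' a'"
        using points_marks_cases[OF u] points_marks_cases[OF v] by metis
      let ?b = "b \<squnion> b'" and ?a = "a \<sqinter> a'"
      have pts: "points ?S = between ?b ?a"
        using i by (auto simp: points_Int in_between join_le_iff le_meet_iff)
      with 6 obtain z where "z \<in> C" "?b \<sqsubseteq> z" "z \<sqsubseteq> ?a" using in_between by blast
      then have "?b \<sqsubseteq> ?a" using i by (meson le_trans join_facts(1) meet_facts(1))
      then have "interval ?x ?b ?a \<in> cells"
        using i x xt by (intro cells.interval) (simp_all add: join_facts meet_facts)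
      moreover have "?S = Point ` between ?b ?a"
        using flagless[of ?S] 6 pts by simp
      ultimately show ?thesis
        by (intro bexI[of _ "interval ?x ?b ?a"]) (simp_all add: marks_simps)
    qed
  qed
qed

lemma meet_cell:
  assumes "u \<in> cells" "v \<in> cells" "w \<in> cells"
    and "proj w = proj u \<sqinter> proj v" "marks w = marks u \<inter> marks v"
  shows "u \<sqinter>\<^bsub>L1\<^esub> v = w"
  by (rule partial_order.meet_eqI[OF partial_order_L1])
     (use assms in \<open>simp_all add: below_def meet_facts proj_in\<close>)

lemma join_cell_ex:
  assumes u: "u \<in> cells" and v: "v \<in> cells"
  shows "\<exists>s\<in>cells. u \<preceq> s \<and> v \<preceq> s \<and> (\<forall>t\<in>cells. u \<preceq> t \<and> v \<preceq> t \<longrightarrow> s \<preceq> t)"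
proof -
  have pts: "points (marks u \<union> marks v) \<subseteq> C" "has_sup_inf (points (marks u \<union> marks v))"
    using u v by (simp_all add: points_Un points_in has_sup_inf_Un has_sup_inf_points)
  have "proj u \<squnion> proj v \<in> C" using u v by (simp add: proj_in join_facts)
  from least_cell_ex[OF this pts] obtain s where "s \<in> cells" "proj u \<squnion> proj v \<sqsubseteq> proj s"
    "marks u \<union> marks v \<subseteq> marks s"
    "\<forall>w\<in>cells. proj u \<squnion> proj v \<sqsubseteq> proj w \<and> marks u \<union> marks v \<subseteq> marks w \<longrightarrow> s \<preceq> w" by blast
  with u v show ?thesis
    by (intro bexI[of _ s]) (auto simp: below_def join_le_iff proj_in)
qed

lemma bounded_lattice_L1: "bounded_lattice L1"
proof (rule partial_order.bounded_latticeI[OF partial_order_L1])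
  show "Inl \<bottom> \<in> carrier L1" "Inl \<top> \<in> carrier L1"
    by (simp_all add: cells.old bottom_in top_in)
next
  fix u v assume uv: "u \<in> carrier L1" "v \<in> carrier L1"
  then show "\<exists>s\<in>carrier L1. u \<sqsubseteq>\<^bsub>L1\<^esub> s \<and> v \<sqsubseteq>\<^bsub>L1\<^esub> s \<and>
      (\<forall>t\<in>carrier L1. u \<sqsubseteq>\<^bsub>L1\<^esub> t \<and> v \<sqsubseteq>\<^bsub>L1\<^esub> t \<longrightarrow> s \<sqsubseteq>\<^bsub>L1\<^esub> t)"
    by (simp add: join_cell_ex)
  from uv obtain w where "w \<in> cells" "proj w = proj u \<sqinter> proj v" "marks w = marks u \<inter> marks v"
    using meet_cell_ex[of u v] by auto
  with uv show "\<exists>i\<in>carrier L1. i \<sqsubseteq>\<^bsub>L1\<^esub> u \<and> i \<sqsubseteq>\<^bsub>L1\<^esub> v \<and>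
      (\<forall>t\<in>carrier L1. t \<sqsubseteq>\<^bsub>L1\<^esub> u \<and> t \<sqsubseteq>\<^bsub>L1\<^esub> v \<longrightarrow> t \<sqsubseteq>\<^bsub>L1\<^esub> i)"
    by (intro bexI[of _ w]) (simp_all add: below_def meet_facts proj_in)
qed (simp_all add: bottom_below below_top)

text \<open>Over a complete \<open>L\<close> the hypotheses on suprema and infima in \<open>least_cell_ex\<close> always hold, so arbitrary
joins of cells exist.\<close>

lemma complete_lattice_L1:
  assumes "complete_lattice L"
  shows "complete_lattice L1"
proof (rule partial_order.complete_lattice_from_sups[OF partial_order_L1])
  have sup: "\<exists>s\<in>C. (\<forall>k\<in>K. k \<sqsubseteq> s) \<and> (\<forall>t\<in>C. (\<forall>k\<in>K. k \<sqsubseteq> t) \<longrightarrow> s \<sqsubseteq> t)"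
    if K: "K \<subseteq> C" for K
  proof -
    obtain s where s: "is_lub L s K"
      using complete_lattice.sup_exists[OF assms K] by blast
    then show ?thesis
      using K by (intro bexI[of _ s]) (simp_all add: least_def Upper_def Int_absorb2 Ball_def)
  qed
  have inf: "\<exists>i\<in>C. (\<forall>k\<in>K. i \<sqsubseteq> k) \<and> (\<forall>t\<in>C. (\<forall>k\<in>K. t \<sqsubseteq> k) \<longrightarrow> t \<sqsubseteq> i)"
    if K: "K \<subseteq> C" for K
  proof -
    obtain i where i: "is_glb L i K"
      using complete_lattice.inf_exists[OF assms K] by blast
    then show ?thesis
      using K by (intro bexI[of _ i]) (simp_all add: greatest_def Lower_def Int_absorb2 Ball_def)
  qed
  fix A assume A: "A \<subseteq> carrier L1"
  let ?S = "\<Union>(marks ` A)"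
  have "proj ` A \<subseteq> C" using A proj_in by auto
  from sup[OF this] obtain x where x: "x \<in> C" "\<forall>k\<in>A. proj k \<sqsubseteq> x"
    "\<forall>t\<in>C. (\<forall>k\<in>A. proj k \<sqsubseteq> t) \<longrightarrow> x \<sqsubseteq> t" by auto
  have "points ?S \<subseteq> C" using A points_in by (fastforce simp: points_def)
  moreover have "has_sup_inf (points ?S)"
  proof -
    obtain i where "i \<in> C" "\<forall>k\<in>points ?S. i \<sqsubseteq> k" "\<forall>t\<in>C. (\<forall>k\<in>points ?S. t \<sqsubseteq> k) \<longrightarrow> t \<sqsubseteq> i"
      using inf[OF calculation] by blast
    moreover obtain s where "s \<in> C" "\<forall>k\<in>points ?S. k \<sqsubseteq> s" "\<forall>t\<in>C. (\<forall>k\<in>points ?S. k \<sqsubseteq> t) \<longrightarrow> s \<sqsubseteq> t"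
      using sup[OF \<open>points ?S \<subseteq> C\<close>] by blast
    ultimately show ?thesis
      unfolding has_sup_inf_def by (intro disjI2 bexI[of _ i] bexI[of _ s]) simp_all
  qed
  ultimately obtain s where s: "s \<in> cells" "x \<sqsubseteq> proj s" "?S \<subseteq> marks s"
    "\<forall>w\<in>cells. x \<sqsubseteq> proj w \<and> ?S \<subseteq> marks w \<longrightarrow> s \<preceq> w"
    using least_cell_ex[OF x(1), of ?S] by blast
  have "is_lub L1 s A"
  proof (rule least_UpperI)
    fix u assume u: "u \<in> A"
    then have "u \<in> cells" "proj u \<sqsubseteq> x" using x A by auto
    then have "proj u \<sqsubseteq> proj s" using x(1) s(1,2) le_trans[of "proj u" x "proj s"] by (simp add: proj_in)
    then show "u \<sqsubseteq>\<^bsub>L1\<^esub> s" using u s by (auto simp: below_def)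
  next
    fix t assume t: "t \<in> Upper L1 A"
    then have ut: "u \<preceq> t" if "u \<in> A" for u
      using that A by (auto simp: Upper_def)
    have "t \<in> cells" using t by (simp add: Upper_def)
    moreover have "x \<sqsubseteq> proj t" using x(3) ut \<open>t \<in> cells\<close> by (simp add: below_def proj_in)
    moreover have "?S \<subseteq> marks t" using ut by (auto simp: below_def)
    ultimately show "s \<sqsubseteq>\<^bsub>L1\<^esub> t" using s by simp
  qed (use A s in simp_all)
  then show "\<exists>s. is_lub L1 s A" ..
qed

lemma L1_join_eqI:
  "\<lbrakk>u \<in> cells; v \<in> cells; s \<in> cells; u \<preceq> s; v \<preceq> s;
    \<And>t. \<lbrakk>t \<in> cells; u \<preceq> t; v \<preceq> t\<rbrakk> \<Longrightarrow> s \<preceq> t\<rbrakk> \<Longrightarrow> u \<squnion>\<^bsub>L1\<^esub> v = s"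
  by (rule partial_order.join_eqI[OF partial_order_L1]) simp_all

lemma top_L1: "\<top>\<^bsub>L1\<^esub> = Inl \<top>"
  by (rule partial_order.top_eqI[OF partial_order_L1]) (simp_all add: top_cell below_top)

lemma bottom_L1: "\<bottom>\<^bsub>L1\<^esub> = Inl \<bottom>"
  by (rule partial_order.bottom_eqI[OF partial_order_L1])
     (simp_all add: cells.old bottom_in bottom_below)

lemma join_old: "\<lbrakk>x \<in> C; y \<in> C\<rbrakk> \<Longrightarrow> Inl x \<squnion>\<^bsub>L1\<^esub> Inl y = Inl (x \<squnion> y)"
  by (rule L1_join_eqI) (simp_all add: old_below cells.old join_facts proj_in)

lemma meet_eq_top_iff: "\<lbrakk>x \<in> C; y \<in> C\<rbrakk> \<Longrightarrow> x \<sqinter> y = \<top> \<longleftrightarrow> x = \<top> \<and> y = \<top>"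
  using top_le_iff[of "x \<sqinter> y"] le_meet_iff[of x y \<top>]
  by (simp add: meet_facts top_in top_le_iff)

lemma meet_old: "\<lbrakk>x \<in> C; y \<in> C\<rbrakk> \<Longrightarrow> Inl x \<sqinter>\<^bsub>L1\<^esub> Inl y = Inl (x \<sqinter> y)"
  by (rule meet_cell) (simp_all add: cells.old meet_facts marks_simps meet_eq_top_iff)

text \<open>The cells \<open>star \<bottom>\<close>, \<open>lo \<bottom>\<close>, \<open>hi \<bottom>\<close> that serve as coefficients exist only if \<open>L\<close> has at least two
elements.\<close>

context
  assumes nontrivial: "\<bottom> \<noteq> \<top>"
begin

lemma join_star:
  assumes x: "x \<in> C" shows "Inl x \<squnion>\<^bsub>L1\<^esub> star \<bottom> = or_top x (star x)"
proof (rule L1_join_eqI)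
  fix t assume "t \<in> cells" "Inl x \<preceq> t" "star \<bottom> \<preceq> t"
  then show "or_top x (star x) \<preceq> t"
    using x by (intro star_below) (auto simp: old_below, auto simp: below_def marks_simps)
qed (use x nontrivial in \<open>auto simp: cells.old bottom_in old_below le_refl
    intro!: or_top_cell below_or_top cells.star\<close>, auto simp: below_def marks_simps bottom_le le_refl)

lemma join_lo:
  assumes x: "x \<in> C" shows "Inl x \<squnion>\<^bsub>L1\<^esub> lo \<bottom> = or_top x (lo x)"
proof (rule L1_join_eqI)
  fix t assume "t \<in> cells" "Inl x \<preceq> t" "lo \<bottom> \<preceq> t"
  then show "or_top x (lo x) \<preceq> t"
    using x by (intro lo_below) (auto simp: old_below, auto simp: below_def marks_simps)
next
  have "lo \<bottom> \<preceq> lo x"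
    using x by (auto simp: below_def marks_simps in_between bottom_le le_bottom_iff)
  then show "lo \<bottom> \<preceq> or_top x (lo x)"
    using nontrivial by (simp add: below_or_top cells.lo bottom_in)
qed (use x nontrivial in \<open>auto simp: cells.old bottom_in old_below le_refl
    intro!: or_top_cell below_or_top cells.lo\<close>, auto simp: below_def marks_simps le_refl)

lemma join_hi:
  assumes x: "x \<in> C" shows "Inl x \<squnion>\<^bsub>L1\<^esub> hi \<bottom> = or_top x (hi x)"
proof (rule L1_join_eqI)
  fix t assume "t \<in> cells" "Inl x \<preceq> t" "hi \<bottom> \<preceq> t"
  then show "or_top x (hi x) \<preceq> t"
    using x by (intro hi_below) (auto simp: old_below, auto simp: below_def marks_simps)
next
  have "x\<^sup>\<bottom> \<sqsubseteq> z" if "z \<in> C" "\<bottom>\<^sup>\<bottom> \<sqsubseteq> z" for z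
    using that x compl_antitone[of \<bottom> x] le_trans[of "x\<^sup>\<bottom>" "\<bottom>\<^sup>\<bottom>" z]
    by (simp add: bottom_in bottom_le compl_in)
  then have "hi \<bottom> \<preceq> hi x"
    using x by (auto simp: below_def marks_simps in_between bottom_le)
  then show "hi \<bottom> \<preceq> or_top x (hi x)"
    using nontrivial by (simp add: below_or_top cells.hi bottom_in)
qed (use x nontrivial in \<open>auto simp: cells.old bottom_in old_below le_refl
    intro!: or_top_cell below_or_top cells.hi\<close>, auto simp: below_def marks_simps le_refl)

lemma all_cell: "interval \<bottom> \<bottom> \<top> \<in> cells"
  using nontrivial by (intro cells.interval) (simp_all add: bottom_in top_in bottom_le)

lemma point_cell: "a \<in> C \<Longrightarrow> interval \<bottom> a a \<in> cells"
  using nontrivial by (intro cells.interval) (simp_all add: bottom_in le_refl)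

lemma bottom_meet_eq: "x \<in> C \<Longrightarrow> \<bottom> \<sqinter> x = \<bottom>"
  by (simp add: le_antisym meet_facts bottom_in bottom_le le_refl)

text \<open>The points of \<open>lo a\<close> are those below \<open>a\<close> and the points of \<open>hi (a\<^sup>\<bottom>)\<close> those above \<open>a\<close>. The meet with the cell
of all points removes the flags and the core; this is also what makes the formula correct for \<open>a = \<bottom>\<close>
and \<open>a = \<top>\<close>, where one of the two joins is the top.\<close>

lemma address_polynomial:
  assumes a: "a \<in> C"
  shows "(interval \<bottom> \<bottom> \<top> \<sqinter>\<^bsub>L1\<^esub> (Inl a \<squnion>\<^bsub>L1\<^esub> lo \<bottom>)) \<sqinter>\<^bsub>L1\<^esub> (Inl (a\<^sup>\<bottom>) \<squnion>\<^bsub>L1\<^esub> hi \<bottom>)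
    = interval \<bottom> a a"
proof -
  have below_a: "interval \<bottom> \<bottom> a \<in> cells"
    using a nontrivial by (intro cells.interval) (simp_all add: bottom_in bottom_le)
  have lo: "or_top a (lo a) \<in> cells" "proj (or_top a (lo a)) = a"
    using a by (simp_all add: or_top_cell cells.lo) (simp add: or_top_def)
  have hi: "or_top (a\<^sup>\<bottom>) (hi (a\<^sup>\<bottom>)) \<in> cells" "proj (or_top (a\<^sup>\<bottom>) (hi (a\<^sup>\<bottom>))) = a\<^sup>\<bottom>"
    using a by (simp_all add: or_top_cell cells.hi compl_in) (simp add: or_top_def)
  have ct: "a \<sqsubseteq> z" if "a\<^sup>\<bottom> = \<top>" "z \<in> C" for z
    using that a compl_le_iff[of "a\<^sup>\<bottom>" z] compl_compl[OF a] by (metis compl_in le_top)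
  have "interval \<bottom> \<bottom> \<top> \<sqinter>\<^bsub>L1\<^esub> or_top a (lo a) = interval \<bottom> \<bottom> a"
    by (rule meet_cell[OF all_cell lo(1) below_a], use a lo in \<open>simp add: bottom_meet_eq\<close>)
       (rule marks_eqI; use a in \<open>auto simp: or_top_def points_Int points_marks in_between le_top;
          auto simp: marks_simps\<close>)
  moreover have "interval \<bottom> \<bottom> a \<sqinter>\<^bsub>L1\<^esub> or_top (a\<^sup>\<bottom>) (hi (a\<^sup>\<bottom>)) = interval \<bottom> a a"
    by (rule meet_cell[OF below_a hi(1) point_cell], use a hi in \<open>simp_all add: bottom_meet_eq compl_in\<close>)
       (rule marks_eqI; use a ct in \<open>auto simp: or_top_def points_Int points_marks in_between le_top
          bottom_le compl_compl; auto simp: marks_simps\<close>)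
  ultimately show ?thesis using a by (simp add: join_lo join_hi compl_in)
qed

text \<open>The step at which the arbitrary function enters: the cells \<open>interval \<bottom> a a\<close> are pairwise incomparable,
so their joins with \<open>star \<bottom>\<close> could be prescribed independently of each other.\<close>

lemma join_point_star:
  assumes a: "a \<in> C" shows "interval \<bottom> a a \<squnion>\<^bsub>L1\<^esub> star \<bottom> = or_top (f a) (hit a)"
proof (rule L1_join_eqI)
  fix t assume "t \<in> cells" "interval \<bottom> a a \<preceq> t" "star \<bottom> \<preceq> t"
  then show "or_top (f a) (hit a) \<preceq> t"
    using a by (intro hit_below) (auto simp: below_def marks_simps between_same)
qed (use a nontrivial in \<open>auto simp: point_cell bottom_in
    intro!: or_top_cell below_or_top cells.star cells.hit\<close>,
    auto simp: below_def marks_simps bottom_le f_in between_same)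

text \<open>The cells \<open>star x\<close> and \<open>lo x\<close> have core \<open>x\<close> and no mark in common.\<close>

lemma meet_star_lo:
  assumes x: "x \<in> C"
  shows "(Inl x \<squnion>\<^bsub>L1\<^esub> star \<bottom>) \<sqinter>\<^bsub>L1\<^esub> (Inl x \<squnion>\<^bsub>L1\<^esub> lo \<bottom>) = Inl x"
proof -
  have "x \<sqinter> x = x" using x by (simp add: le_antisym meet_facts le_refl)
  then show ?thesis
    using x by (simp add: join_star join_lo, intro meet_cell)
      (auto simp: or_top_def marks_simps top_cell cells.old cells.star cells.lo)
qed

end

section \<open>Representing the function by a polynomial\<close>

abbreviation copy :: "'a ext ortho_struct" where "copy \<equiv> ortho_copy Inl L"

lemma inj_old: "inj_on (Inl :: 'a \<Rightarrow> 'a ext) C"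
  by simp

lemmas ortholattice_copy = ortholattice_ortho_copy[OF ol inj_old]
  and copy_simps = ortho_copy_carrier[OF ol inj_old] ortho_copy_le[OF ol inj_old]
    ortho_copy_ocompl[OF ol inj_old] ortho_copy_join[OF ol inj_old] ortho_copy_meet[OF ol inj_old]
    ortho_copy_top[OF ol inj_old] ortho_copy_bottom[OF ol inj_old]

text \<open>Old elements other than the top have no marks, while all new cells have some; hence no new cell
lies below an old one other than the top.\<close>

lemma normal_L1: "copy \<unlhd> L1"
proof -
  have bl: "bounded_lattice copy"
    using ortholattice_copy by (rule ortholattice.axioms(1))
  have "bounded_sublattice copy L1"
    unfolding bounded_sublattice_def
    by (intro conjI bl bounded_lattice_L1)
       (auto simp: copy_simps join_old meet_old top_L1 bottom_L1 old_below cells.old)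
  moreover have "\<exists>g. greatest L1 g {z \<in> carrier copy. z \<sqsubseteq>\<^bsub>L1\<^esub> u}" if u: "u \<in> carrier L1" for u
    using u by (intro exI[of _ "Inl (proj u)"])
      (auto simp: greatest_def copy_simps cells.old proj_in old_below le_refl)
  moreover have "u \<in> carrier copy"
    if z: "z \<in> carrier copy - {\<top>\<^bsub>L1\<^esub>}" and u: "u \<in> carrier L1" "u \<sqsubseteq>\<^bsub>L1\<^esub> z" for z u
  proof -
    from z obtain x where "z = Inl x" "x \<noteq> \<top>" by (auto simp: copy_simps top_L1)
    then have no_marks: "marks u = {}" using u by (simp add: below_def marks_simps)
    have "u \<in> cells" using u by simp
    then have "u \<in> Inl ` C"
    proof (cases rule: cells.cases)
      case (interval x b a)
      then have "b \<in> between b a" by (simp add: in_between le_refl)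
      with interval no_marks show ?thesis by (simp add: marks_simps)
    qed (use no_marks in \<open>auto simp: marks_simps\<close>)
    then show ?thesis by (simp add: copy_simps)
  qed
  ultimately show ?thesis
    unfolding normal_sublattice_def by blast
qed

text \<open>The tags of cells are at most 4, so adding 5 yields elements outside \<open>cells\<close>.\<close>

definition mirror :: "'a ext \<Rightarrow> 'a ext" where
  "mirror u = (case u of Inl x \<Rightarrow> Inl (x\<^sup>\<bottom>) | Inr (k, l) \<Rightarrow> Inr (k + 5, l))"

lemma mirror_simps: "mirror (Inl x) = Inl (x\<^sup>\<bottom>)" "mirror (Inr (k, l)) = Inr (k + 5, l)"
  by (simp_all add: mirror_def)

lemma cells_tag: "Inr (k, l) \<in> cells \<Longrightarrow> k < 5"
  by (erule cells.cases) auto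

lemma cells_Inl: "Inl x \<in> cells \<longleftrightarrow> x \<in> C"
  by (auto intro: cells.old elim: cells.cases)

lemma dual_copy_mirror: "dual_copy_map copy L1 mirror"
proof -
  have "inj_on mirror cells"
  proof (rule inj_onI)
    fix u v assume "u \<in> cells" "v \<in> cells" "mirror u = mirror v"
    then show "u = v"
      using compl_compl by (cases u; cases v) (auto simp: mirror_def cells_Inl, metis)
  qed
  moreover have "cells \<inter> mirror ` cells = Inl ` C"
  proof (intro equalityI subsetI)
    fix u assume "u \<in> cells \<inter> mirror ` cells"
    then obtain v where v: "u \<in> cells" "v \<in> cells" "u = mirror v" by blast
    then show "u \<in> Inl ` C"
    proof (cases v)
      case (Inl x)
      with v show ?thesis by (simp add: mirror_simps cells_Inl)
    next
      case (Inr p)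
      with v show ?thesis using cells_tag by (cases p) (auto simp: mirror_simps)
    qed
  next
    fix u :: "'a ext" assume "u \<in> Inl ` C"
    then obtain x where x: "x \<in> C" "u = (Inl x :: 'a ext)" by blast
    then have "u = mirror (Inl (x\<^sup>\<bottom>))" by (simp add: mirror_simps compl_compl)
    then have "u \<in> mirror ` cells" using x by (simp add: cells_Inl compl_in)
    with x show "u \<in> cells \<inter> mirror ` cells" by (simp add: cells_Inl)
  qed
  ultimately show ?thesis
    by (auto simp: dual_copy_map_def copy_simps mirror_simps)
qed

lemma gluing: "ortho_gluing copy L1 mirror"
  by (simp add: ortho_gluing_def ortholattice_copy normal_L1 dual_copy_mirror)

text \<open>The subpolynomial \<open>?z\<close> computes the cell with single point \<open>a\<close>, its join with \<open>star \<bottom>\<close> computes \<open>hit a\<close>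
(or the top if \<open>f a = \<top>\<close>), and the rest extracts the core of that cell with \<open>e = star \<bottom>\<close> and
\<open>e' = star \<bottom>, lo \<bottom>\<close>.\<close>

theorem polynomial_extension_ortho_glue: "polynomial_extension Inl L f (ortho_glue L1 mirror)"
proof -
  interpret ortho_gluing copy L1 mirror by (rule gluing)
  have "\<exists>p :: (unit, 'a ext) orthopoly. coefficients p \<subseteq> carrier G \<and>
      (\<forall>a\<in>C. orthopoly_eval G (\<lambda>_. Inl a) p = Inl (f a))"
  proof (cases "\<bottom> = \<top>")
    case True
    \<comment> \<open>In the one-element ortholattice \<open>f\<close> is the identity.\<close>
    have "x = \<top>" if "x \<in> C" for x
      using that True bottom_le[of x] top_le_iff[of x] by simp
    then have "f a = a" if "a \<in> C" for a using that f_in by metis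
    then show ?thesis by (intro exI[of _ "Var ()"]) simp
  next
    case False
    let ?q = "interval \<bottom> \<bottom> \<top>" and ?c = "lo \<bottom>" and ?d = "hi \<bottom>" and ?h = "star \<bottom>"
    let ?z = "Meet (Meet (Coeff ?q) (Join (Var ()) (Coeff ?c))) (Join (Compl (Var ())) (Coeff ?d))"
    let ?w = "Meet (Join ?z (Coeff ?h)) (Coeff (mirror ?h))"
    let ?p = "Meet (Join ?w (Coeff ?h)) (Join ?w (Coeff ?c)) :: (unit, 'a ext) orthopoly"
    have cells: "?q \<in> cells" "?c \<in> cells" "?d \<in> cells" "?h \<in> cells"
      using False by (simp_all add: all_cell cells.lo cells.hi cells.star bottom_in)
    then have "coefficients ?p \<subseteq> carrier G"
      by (auto simp: carrierG)
    moreover have "orthopoly_eval G (\<lambda>_. Inl a) ?p = Inl (f a)" if a: "a \<in> C" for a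
    proof -
      let ?u = "or_top (f a) (hit a)"
      have ac: "Inl a \<in> cells" "Inl (a\<^sup>\<bottom>) \<in> cells" using a by (simp_all add: cells_Inl compl_in)
      have u: "?u \<in> cells" "proj ?u = f a"
        using a by (simp_all add: or_top_cell cells.hit) (simp add: or_top_def)
      have closed: "u \<squnion>\<^bsub>L1\<^esub> v \<in> cells" "u \<sqinter>\<^bsub>L1\<^esub> v \<in> cells" if "u \<in> cells" "v \<in> cells" for u v
        using join1(1)[of u v] meet1(1)[of u v] that by simp_all
      have "orthopoly_eval G (\<lambda>_. Inl a) ?z = interval \<bottom> a a"
        using a ac cells closed address_polynomial[OF False a]
        by (simp add: join_G1 meet_G1 complG1 mirror_simps)
      then have hit: "orthopoly_eval G (\<lambda>_. Inl a) (Join ?z (Coeff ?h)) = ?u"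
        using a cells point_cell[OF False a] join_point_star[OF False a]
        by (simp add: join_G1)
      have core: "core v = Inl (proj v)" if "v \<in> cells" for v
        using that by (intro core_eqI) (auto simp: copy_simps cells_Inl proj_in old_below le_refl)
      have new: "?h \<in> C1 - (carrier copy - {\<top>\<^bsub>L1\<^esub>})"
        "?c \<in> C1 - (carrier copy - {\<top>\<^bsub>L1\<^esub>})"
        using cells by (auto simp: copy_simps)
      have "proj (or_top x (star x)) = x" for x by (simp add: or_top_def)
      then have "core (?h \<squnion>\<^bsub>L1\<^esub> Inl x) = Inl x" if "x \<in> C" for x
        using that join_star[OF False that] cells
        by (simp add: join_comm[of L1 ?h] core or_top_cell cells.star)
      then have core_h: "core (?h \<squnion>\<^bsub>L1\<^esub> compl0 (core ?u)) = compl0 (core ?u)"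
        using u a by (simp add: core copy_simps f_in compl_in)
      have "orthopoly_eval G (\<lambda>_. Inl a) (Join ?w (Coeff e)) = Inl (f a) \<squnion>\<^bsub>L1\<^esub> e"
        if "e \<in> C1 - (carrier copy - {\<top>\<^bsub>L1\<^esub>})" for e
        using join_meet_recovers_core[OF _ new(1) that core_h] u hit by (simp add: core)
      then have "orthopoly_eval G (\<lambda>_. Inl a) ?p
          = (Inl (f a) \<squnion>\<^bsub>L1\<^esub> ?h) \<sqinter>\<^bsub>G\<^esub> (Inl (f a) \<squnion>\<^bsub>L1\<^esub> ?c)"
        using new by (simp only: orthopoly_eval.simps(4))
      then show ?thesis
        using meet_star_lo[OF False f_in[OF a]] f_in[OF a] cells
        by (simp add: meet_G1 closed cells_Inl)
    qed
    ultimately show ?thesis by blast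
  qed
  then show ?thesis
    by (simp add: polynomial_extension_def ortholattice_G subortholattice_G)
qed

lemma is_ortho_glue: "is_ortho (ortho_glue L1 mirror) L1 copy"
  using ortholattice_copy normal_L1 dual_copy_mirror
  by (auto simp: is_ortho_def)

end

theorem theorem4p1:
  fixes L0 :: "'a ortho_struct" and f :: "'a \<Rightarrow> 'a"
  assumes "ortholattice L0"
    and "f \<in> carrier L0 \<rightarrow> carrier L0"
  shows "(\<exists>Lstar :: 'a ext ortho_struct. polynomial_extension Inl L0 f Lstar) \<and>
         (complete_lattice L0 \<longrightarrow>
            (\<exists>(Lstar :: 'a ext ortho_struct) (L1 :: 'a ext gorder).
               polynomial_extension Inl L0 f Lstar \<and>
               complete_lattice L1 \<and>
               ortho_copy Inl L0 \<unlhd> L1 \<and>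
               is_ortho Lstar L1 (ortho_copy Inl L0)))"
proof -
  interpret cell_extension L0 f
    using assms by (rule cell_extension.intro)
  show ?thesis
    using polynomial_extension_ortho_glue complete_lattice_L1 normal_L1 is_ortho_glue by blast
qed

end
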